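(* Let $A$ be an order-unit space and let $L$ be a lower semi-continuous Lip-norm on $A$. Then there exist a Hilbert space $\mathcal{H}$, a (usually unbounded) self-adjoint operator $D$ on $\mathcal{H}$, and an isomorphism, as order-unit spaces, of $A$ onto an order-unit space of bounded self-adjoint operators on $\mathcal{H}$ (with the identity operator as order unit) such that, identifying each $a\in A$ with the corresponding operator, the commutator $[D,a]$ is a bounded operator on $\mathcal{H}$ and $$L(a)=\|[D,a]\|\quad\text{for all } a\in A .$$
   Context: An order-unit space is a real partially ordered vector space $A$ with a distinguished element $e$ (the order unit) such that (1) for each $a\in A$ there is $r\in\mathbb{R}$ with $a\le re$; (2) if $a\in A$ and $a\le re$ for all real $r>0$, then $a\le 0$. Its norm is $\|a\|=\inf\{r: -re\le a\le re\}$. A state is an element $\mu$ of the Banach-space dual $A'$ with $\mu(e)=1=\|\mu\|'$; $S(A)$ denotes the set of states, with the $w^*$-topology. For a seminorm $L$ on $A$ put $\rho_L(\mu,\nu)=\sup\{|\mu(a)-\nu(a)|: L(a)\le 1\}$ for $\mu,\nu\in S(A)$. A Lip-norm on $A$ is a (finite-valued) seminorm $L$ such that $L(a)=0$ iff $a\in\mathbb{R}e$, and the topology on $S(A)$ from $\rho_L$ is the $w^*$-topology. Lower semi-continuity of $L$ is with respect to the norm of $A$. A linear space of self-adjoint operators containing the identity is an order-unit space for the usual operator order. Saying that $[D,a]$ is bounded means that $a$ carries the domain of $D$ into itself and $Da-aD$, defined on this (dense) domain, extends to a bounded operator on $\mathcal{H}$, also denoted $[D,a]$. *)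

theory Defs
  imports "HOL-Analysis.Analysis" "HOL-Algebra.Module" "HOL-Algebra.Algebraic_Closure_Type"
begin

section \<open>Order-unit spaces\<close>

(* 0 <= e is part of what "order unit" means; without it the norm below would not be defined
   (take the real line with e = -1). *)
definition order_unit_space :: "'a::ordered_real_vector \<Rightarrow> bool" where
  "order_unit_space e \<longleftrightarrow> 0 \<le> e \<and> (\<forall>a. \<exists>r. a \<le> r *\<^sub>R e) \<and>
     (\<forall>a. (\<forall>r>0. a \<le> r *\<^sub>R e) \<longrightarrow> a \<le> 0)"

(* In an order-unit space with e \<noteq> 0 the condition 0 <= r is automatic; it only serves to give
   the zero space the norm 0. *)
definition ou_norm :: "'a::ordered_real_vector \<Rightarrow> 'a \<Rightarrow> real" where
  "ou_norm e a = Inf {r. 0 \<le> r \<and> - (r *\<^sub>R e) \<le> a \<and> a \<le> r *\<^sub>R e}"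

definition ou_dual :: "'a::ordered_real_vector \<Rightarrow> ('a \<Rightarrow> real) set" where
  "ou_dual e = {\<mu>. linear \<mu> \<and> (\<exists>K. \<forall>a. \<bar>\<mu> a\<bar> \<le> K * ou_norm e a)}"

definition ou_dual_norm :: "'a::ordered_real_vector \<Rightarrow> ('a \<Rightarrow> real) \<Rightarrow> real" where
  "ou_dual_norm e \<mu> = Sup {\<bar>\<mu> a\<bar> | a. ou_norm e a \<le> 1}"

definition states :: "'a::ordered_real_vector \<Rightarrow> ('a \<Rightarrow> real) set" where
  "states e = {\<mu> \<in> ou_dual e. \<mu> e = 1 \<and> ou_dual_norm e \<mu> = 1}"

(* The weak-star topology is the topology of pointwise convergence on A. *)
definition weak_star_topology :: "'a::ordered_real_vector \<Rightarrow> ('a \<Rightarrow> real) topology" where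
  "weak_star_topology e = subtopology (product_topology (\<lambda>_. euclideanreal) UNIV) (states e)"

section \<open>Lip-norms\<close>

definition seminorm :: "('a::real_vector \<Rightarrow> real) \<Rightarrow> bool" where
  "seminorm L \<longleftrightarrow> (\<forall>a. 0 \<le> L a) \<and> (\<forall>a b. L (a + b) \<le> L a + L b) \<and>
     (\<forall>r a. L (r *\<^sub>R a) = \<bar>r\<bar> * L a)"

(* For a general seminorm the supremum may be infinite. *)
definition lip_dist :: "('a \<Rightarrow> real) \<Rightarrow> ('a \<Rightarrow> real) \<Rightarrow> ('a \<Rightarrow> real) \<Rightarrow> ereal" where
  "lip_dist L \<mu> \<nu> = (SUP a \<in> {a. L a \<le> 1}. ereal \<bar>\<mu> a - \<nu> a\<bar>)"

definition lip_open ::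
  "'a::ordered_real_vector \<Rightarrow> ('a \<Rightarrow> real) \<Rightarrow> ('a \<Rightarrow> real) set \<Rightarrow> bool" where
  "lip_open e L U \<longleftrightarrow> U \<subseteq> states e \<and>
     (\<forall>\<mu>\<in>U. \<exists>\<epsilon>>0. \<forall>\<nu>\<in>states e. lip_dist L \<mu> \<nu> < ereal \<epsilon> \<longrightarrow> \<nu> \<in> U)"

definition lip_topology ::
  "'a::ordered_real_vector \<Rightarrow> ('a \<Rightarrow> real) \<Rightarrow> ('a \<Rightarrow> real) topology" where
  "lip_topology e L = topology (lip_open e L)"

lemma istopology_lip_open: "istopology (lip_open e L)"
  unfolding istopology_def
proof (intro conjI allI impI)
  fix S T assume S: "lip_open e L S" and T: "lip_open e L T"
  have "\<exists>\<epsilon>>0. \<forall>\<nu>\<in>states e. lip_dist L \<mu> \<nu> < ereal \<epsilon> \<longrightarrow> \<nu> \<in> S \<inter> T"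
    if \<mu>: "\<mu> \<in> S" "\<mu> \<in> T" for \<mu>
  proof -
    from S \<mu>(1) obtain \<epsilon> where \<epsilon>: "\<epsilon> > 0"
      "\<And>\<nu>. \<nu> \<in> states e \<Longrightarrow> lip_dist L \<mu> \<nu> < ereal \<epsilon> \<Longrightarrow> \<nu> \<in> S"
      unfolding lip_open_def by blast
    from T \<mu>(2) obtain \<delta> where \<delta>: "\<delta> > 0"
      "\<And>\<nu>. \<nu> \<in> states e \<Longrightarrow> lip_dist L \<mu> \<nu> < ereal \<delta> \<Longrightarrow> \<nu> \<in> T"
      unfolding lip_open_def by blast
    have "\<nu> \<in> S \<inter> T" if "\<nu> \<in> states e" and less: "lip_dist L \<mu> \<nu> < ereal (min \<epsilon> \<delta>)" for \<nu>
    proof -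
      have "ereal (min \<epsilon> \<delta>) \<le> ereal \<epsilon>" "ereal (min \<epsilon> \<delta>) \<le> ereal \<delta>"
        by simp_all
      then have "lip_dist L \<mu> \<nu> < ereal \<epsilon>" "lip_dist L \<mu> \<nu> < ereal \<delta>"
        using less_le_trans[OF less] by blast+
      then show ?thesis
        using \<epsilon>(2) \<delta>(2) \<open>\<nu> \<in> states e\<close> by blast
    qed
    moreover have "min \<epsilon> \<delta> > 0"
      using \<epsilon>(1) \<delta>(1) by simp
    ultimately show ?thesis
      by blast
  qed
  then show "lip_open e L (S \<inter> T)"
    using S by (simp add: lip_open_def subset_iff)
next
  fix K assume K: "\<forall>S\<in>K. lip_open e L S"
  have "\<exists>\<epsilon>>0. \<forall>\<nu>\<in>states e. lip_dist L \<mu> \<nu> < ereal \<epsilon> \<longrightarrow> \<nu> \<in> \<Union>K"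
    if \<mu>: "\<mu> \<in> S" "S \<in> K" for \<mu> S
  proof -
    have "lip_open e L S"
      using K \<mu>(2) by (rule bspec)
    then obtain \<epsilon> where \<epsilon>: "\<epsilon> > 0"
      "\<And>\<nu>. \<nu> \<in> states e \<Longrightarrow> lip_dist L \<mu> \<nu> < ereal \<epsilon> \<Longrightarrow> \<nu> \<in> S"
      unfolding lip_open_def using \<mu>(1) by blast
    show ?thesis
      by (intro exI[of _ \<epsilon>] conjI ballI impI \<epsilon>(1) UnionI[OF \<mu>(2)] \<epsilon>(2))
  qed
  moreover have "\<Union>K \<subseteq> states e"
  proof (rule Union_least)
    fix S assume "S \<in> K"
    with K have "lip_open e L S" by (rule bspec)
    then show "S \<subseteq> states e" by (simp add: lip_open_def)
  qed
  ultimately show "lip_open e L (\<Union>K)"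
    by (simp only: lip_open_def) (meson UnionE)
qed

lemma openin_lip_topology: "openin (lip_topology e L) U \<longleftrightarrow> lip_open e L U"
  by (simp add: lip_topology_def istopology_lip_open)

definition lip_norm :: "'a::ordered_real_vector \<Rightarrow> ('a \<Rightarrow> real) \<Rightarrow> bool" where
  "lip_norm e L \<longleftrightarrow> seminorm L \<and> (\<forall>a. L a = 0 \<longleftrightarrow> a \<in> range (\<lambda>r. r *\<^sub>R e)) \<and>
     lip_topology e L = weak_star_topology e"

definition lower_semicontinuous ::
  "'a::ordered_real_vector \<Rightarrow> ('a \<Rightarrow> real) \<Rightarrow> bool" where
  "lower_semicontinuous e L \<longleftrightarrow>
     (\<forall>a. \<forall>\<epsilon>>0. \<exists>\<delta>>0. \<forall>b. ou_norm e (b - a) < \<delta> \<longrightarrow> L a - \<epsilon> < L b)"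

section \<open>Complex Hilbert spaces and their operators\<close>

(* Hilbert spaces are carrier-based, since HOL cannot quantify existentially over types.
   The fields mult and one inherited from the ring record are irrelevant. *)
record 'h hilbert = "(complex, 'h) module" +
  cinner :: "'h \<Rightarrow> 'h \<Rightarrow> complex"

definition hnorm :: "('h, 'm) hilbert_scheme \<Rightarrow> 'h \<Rightarrow> real" where
  "hnorm H x = sqrt (Re (cinner H x x))"

locale complex_hilbert_space = module "ring_of_type_algebra :: complex ring" H
  for H :: "('h, 'm) hilbert_scheme" (structure) +
  assumes cinner_commute:
      "\<lbrakk>x \<in> carrier H; y \<in> carrier H\<rbrakk> \<Longrightarrow> cinner H y x = cnj (cinner H x y)"
    and cinner_add_left:
      "\<lbrakk>x \<in> carrier H; y \<in> carrier H; z \<in> carrier H\<rbrakk>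
        \<Longrightarrow> cinner H (x \<oplus>\<^bsub>H\<^esub> y) z = cinner H x z + cinner H y z"
    and cinner_smult_left:
      "\<lbrakk>x \<in> carrier H; y \<in> carrier H\<rbrakk> \<Longrightarrow> cinner H (c \<odot>\<^bsub>H\<^esub> x) y = c * cinner H x y"
    and cinner_nonneg: "x \<in> carrier H \<Longrightarrow> cinner H x x \<in> \<real>\<^sub>\<ge>\<^sub>0"
    and cinner_definite: "\<lbrakk>x \<in> carrier H; cinner H x x = 0\<rbrakk> \<Longrightarrow> x = \<zero>\<^bsub>H\<^esub>"
    and complete:
      "\<lbrakk>\<And>n. s n \<in> carrier H;
        \<forall>\<epsilon>>0. \<exists>N. \<forall>m\<ge>N. \<forall>n\<ge>N. hnorm H (s m \<ominus>\<^bsub>H\<^esub> s n) < \<epsilon>\<rbrakk>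
        \<Longrightarrow> \<exists>x\<in>carrier H. (\<lambda>n. hnorm H (s n \<ominus>\<^bsub>H\<^esub> x)) \<longlonglongrightarrow> 0"

(* An operator is given by its domain V and a function T, of which only the values on V matter. *)
definition linear_operator ::
  "('h, 'm) hilbert_scheme \<Rightarrow> 'h set \<Rightarrow> ('h \<Rightarrow> 'h) \<Rightarrow> bool" where
  "linear_operator H V T \<longleftrightarrow>
     submodule V (ring_of_type_algebra :: complex ring) H \<and> T \<in> V \<rightarrow> carrier H \<and>
     (\<forall>x\<in>V. \<forall>y\<in>V. T (x \<oplus>\<^bsub>H\<^esub> y) = T x \<oplus>\<^bsub>H\<^esub> T y) \<and>
     (\<forall>c. \<forall>x\<in>V. T (c \<odot>\<^bsub>H\<^esub> x) = c \<odot>\<^bsub>H\<^esub> T x)"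

definition dense_subset :: "('h, 'm) hilbert_scheme \<Rightarrow> 'h set \<Rightarrow> bool" where
  "dense_subset H V \<longleftrightarrow> V \<subseteq> carrier H \<and>
     (\<forall>x\<in>carrier H. \<forall>\<epsilon>>0. \<exists>v\<in>V. hnorm H (x \<ominus>\<^bsub>H\<^esub> v) < \<epsilon>)"

definition adjoint_graph ::
  "('h, 'm) hilbert_scheme \<Rightarrow> 'h set \<Rightarrow> ('h \<Rightarrow> 'h) \<Rightarrow> ('h \<times> 'h) set" where
  "adjoint_graph H V T = {(y, z). y \<in> carrier H \<and> z \<in> carrier H \<and>
     (\<forall>x\<in>V. cinner H (T x) y = cinner H x z)}"

definition self_adjoint ::
  "('h, 'm) hilbert_scheme \<Rightarrow> 'h set \<Rightarrow> ('h \<Rightarrow> 'h) \<Rightarrow> bool" where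
  "self_adjoint H V T \<longleftrightarrow> linear_operator H V T \<and> dense_subset H V \<and>
     adjoint_graph H V T = {(x, T x) | x. x \<in> V}"

(* Everywhere defined operators are extensional functions on the carrier, so that equality of
   functions is equality of operators. *)
definition bounded_operators :: "('h, 'm) hilbert_scheme \<Rightarrow> ('h \<Rightarrow> 'h) set" where
  "bounded_operators H = {T \<in> extensional (carrier H). linear_operator H (carrier H) T \<and>
     (\<exists>K. \<forall>x\<in>carrier H. hnorm H (T x) \<le> K * hnorm H x)}"

definition opnorm :: "('h, 'm) hilbert_scheme \<Rightarrow> ('h \<Rightarrow> 'h) \<Rightarrow> real" where
  "opnorm H T = Sup {hnorm H (T x) | x. x \<in> carrier H \<and> hnorm H x \<le> 1}"

definition op_id :: "('h, 'm) hilbert_scheme \<Rightarrow> 'h \<Rightarrow> 'h" where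
  "op_id H = (\<lambda>x\<in>carrier H. x)"

definition op_add ::
  "('h, 'm) hilbert_scheme \<Rightarrow> ('h \<Rightarrow> 'h) \<Rightarrow> ('h \<Rightarrow> 'h) \<Rightarrow> 'h \<Rightarrow> 'h" where
  "op_add H S T = (\<lambda>x\<in>carrier H. S x \<oplus>\<^bsub>H\<^esub> T x)"

definition op_scaleR :: "('h, 'm) hilbert_scheme \<Rightarrow> real \<Rightarrow> ('h \<Rightarrow> 'h) \<Rightarrow> 'h \<Rightarrow> 'h" where
  "op_scaleR H r T = (\<lambda>x\<in>carrier H. complex_of_real r \<odot>\<^bsub>H\<^esub> T x)"

definition op_le :: "('h, 'm) hilbert_scheme \<Rightarrow> ('h \<Rightarrow> 'h) \<Rightarrow> ('h \<Rightarrow> 'h) \<Rightarrow> bool" where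
  "op_le H S T \<longleftrightarrow> (\<forall>x\<in>carrier H. cinner H (T x \<ominus>\<^bsub>H\<^esub> S x) x \<in> \<real>\<^sub>\<ge>\<^sub>0)"

definition operator_order_unit_space ::
  "('h, 'm) hilbert_scheme \<Rightarrow> ('h \<Rightarrow> 'h) set \<Rightarrow> bool" where
  "operator_order_unit_space H B \<longleftrightarrow>
     B \<subseteq> {T \<in> bounded_operators H. self_adjoint H (carrier H) T} \<and> op_id H \<in> B \<and>
     (\<forall>S\<in>B. \<forall>T\<in>B. op_add H S T \<in> B) \<and> (\<forall>r. \<forall>T\<in>B. op_scaleR H r T \<in> B)"

definition order_unit_isomorphism ::
  "'a::ordered_real_vector \<Rightarrow> ('h, 'm) hilbert_scheme \<Rightarrow> ('h \<Rightarrow> 'h) set \<Rightarrow>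
    ('a \<Rightarrow> 'h \<Rightarrow> 'h) \<Rightarrow> bool" where
  "order_unit_isomorphism e H B \<pi> \<longleftrightarrow> bij_betw \<pi> UNIV B \<and>
     (\<forall>a b. \<pi> (a + b) = op_add H (\<pi> a) (\<pi> b)) \<and>
     (\<forall>r a. \<pi> (r *\<^sub>R a) = op_scaleR H r (\<pi> a)) \<and>
     (\<forall>a b. a \<le> b \<longleftrightarrow> op_le H (\<pi> a) (\<pi> b)) \<and> \<pi> e = op_id H"

(* [D,T] is bounded and C is its (by density unique) bounded extension; V is the domain of D. *)
definition is_bounded_commutator ::
  "('h, 'm) hilbert_scheme \<Rightarrow> 'h set \<Rightarrow> ('h \<Rightarrow> 'h) \<Rightarrow> ('h \<Rightarrow> 'h) \<Rightarrow> ('h \<Rightarrow> 'h) \<Rightarrow> bool" where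
  "is_bounded_commutator H V D T C \<longleftrightarrow> T ` V \<subseteq> V \<and> C \<in> bounded_operators H \<and>
     (\<forall>x\<in>V. C x = D (T x) \<ominus>\<^bsub>H\<^esub> T (D x))"

end

theory Submission
  imports Defs
begin

text \<open>Let $S$ be the set of positive normalized functionals on $A$. On $\ell^2(S \times S)$ let $a$ act
  as multiplication by $\mu(a)$ at $(\mu, \nu)$, and let $D$ be the flip of the two coordinates followed
  by multiplication with $w(\mu, \nu) = 1 / \rho_L(\mu, \nu)$. Then $[D, a]$ is the flip followed by
  multiplication with $w(\mu, \nu) (\nu(a) - \mu(a))$, so its norm is the supremum of
  $|\mu(a) - \nu(a)| / \rho_L(\mu, \nu)$, which is at most $L(a)$. For the converse, lower
  semi-continuity and the Hahn-Banach theorem give a norm-bounded functional $\phi$ with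
  $|\phi| \le L$ and $\phi(a)$ close to $L(a)$; as $\phi(e) = 0$, its decomposition into positive
  parts has the form $t (\mu - \nu)$, and $|\phi| \le L$ means that $\rho_L(\mu, \nu) \le 1/t$.\<close>

section \<open>The Hahn-Banach theorem for sublinear functionals\<close>

text \<open>Multiplication operators commute with each other, so D has to move coordinates. The flip
  is chosen because it is its own inverse and sends a coordinate where a acts by \<mu>(a) to one
  where it acts by \<nu>(a). Since the weight is real and symmetric in the two states, the weighted
  flip is formally symmetric. The weight may be unbounded when states come close, so genuine
  self-adjointness is obtained by giving D its maximal domain. On the order side the obstacle is
  that a linear functional dominated by L alone may be discontinuous for the order-unit norm, and
  then it has no decomposition into positive functionals. The functional is therefore dominated by a
  sublinear functional below both L and a multiple of the norm; lower semi-continuity is what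
  prevents this smaller functional from dropping too far at a.\<close>

definition sublinear :: "('a::real_vector \<Rightarrow> real) \<Rightarrow> bool" where
  "sublinear p \<longleftrightarrow> (\<forall>x y. p (x + y) \<le> p x + p y) \<and> (\<forall>r x. 0 \<le> r \<longrightarrow> p (r *\<^sub>R x) = r * p x)"

lemma sublinear_zero: "sublinear p \<Longrightarrow> p 0 = 0"
  unfolding sublinear_def by (metis mult_zero_left order_refl scaleR_zero_left)

lemma sublinear_minus:
  assumes "sublinear p"
  shows "- p (- x) \<le> p x"
proof -
  have "p (x + - x) \<le> p x + p (- x)"
    using assms unfolding sublinear_def by blast
  then show ?thesis using sublinear_zero[OF assms] by simp
qed

text \<open>C is a convex cone in the product with the real line, and the infimum is its lower
  boundary. The tilt of a functional, the lower bound of a chain, the majorant and the infimal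
  convolution below are all of this kind, so each is reduced to checking that a set is a cone,
  bounded below and nonempty on every fibre.\<close>

lemma sublinear_Inf:
  fixes C :: "('a::real_vector \<times> real) set"
  assumes add: "\<And>x y s t. (x, s) \<in> C \<Longrightarrow> (y, t) \<in> C \<Longrightarrow> (x + y, s + t) \<in> C"
    and scale: "\<And>r x t. (x, t) \<in> C \<Longrightarrow> 0 \<le> r \<Longrightarrow> (r *\<^sub>R x, r * t) \<in> C"
    and bdd: "\<And>x. bdd_below {t. (x, t) \<in> C}"
    and nonempty: "\<And>x. \<exists>t. (x, t) \<in> C"
  shows "sublinear (\<lambda>x. Inf {t. (x, t) \<in> C})"
proof -
  let ?q = "\<lambda>x. Inf {t. (x, t) \<in> C}"
  have lower: "?q x \<le> t" if "(x, t) \<in> C" for x t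
    using that bdd by (intro cInf_lower) auto
  have greatest: "B \<le> ?q x" if "\<And>t. (x, t) \<in> C \<Longrightarrow> B \<le> t" for B x
    using that nonempty by (intro cInf_greatest) auto
  have q_add: "?q (x + y) \<le> ?q x + ?q y" for x y
  proof -
    have "?q (x + y) - t \<le> ?q x" if t: "(y, t) \<in> C" for t
    proof (rule greatest)
      fix s assume "(x, s) \<in> C"
      then show "?q (x + y) - t \<le> s"
        using lower[OF add[OF _ t]] by (simp add: algebra_simps)
    qed
    then have "?q (x + y) - ?q x \<le> ?q y"
      by (intro greatest) (simp add: algebra_simps)
    then show ?thesis by simp
  qed
  \<comment> \<open>One inequality is enough: used for \<open>inverse r\<close> at
    \<open>r *\<^sub>R x\<close> it becomes the reverse one.\<close>
  have scale_le: "r * ?q x \<le> ?q (r *\<^sub>R x)" if r: "0 < r" for r x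
  proof (rule greatest)
    fix t assume "(r *\<^sub>R x, t) \<in> C"
    then have "(x, t / r) \<in> C"
      using scale[of "r *\<^sub>R x" t "inverse r"] r by (simp add: field_simps)
    then show "r * ?q x \<le> t"
      using lower[of x "t / r"] r by (simp add: field_simps)
  qed
  have q_scale: "?q (r *\<^sub>R x) = r * ?q x" if "0 \<le> r" for r x
  proof (cases "r = 0")
    case True
    obtain t where "(x, t) \<in> C" using nonempty by blast
    then have "?q 0 \<le> 0" using lower scale[of x t 0] by simp
    moreover have "0 \<le> ?q 0" using q_add[of 0 0] by simp
    ultimately show ?thesis using True by simp
  next
    case False
    then show ?thesis
      using that scale_le[of r x] scale_le[of "inverse r" "r *\<^sub>R x"]
      by (intro antisym) (auto simp: field_simps)
  qed
  show ?thesis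
    using q_add q_scale by (simp add: sublinear_def)
qed

text \<open>The witness is $q(x) = \inf_{t \ge 0} p(x + t x_0) - t p(x_0)$. It shows that a minimal $p$ is odd,
  hence linear, and it makes a minimal functional below $q$ agree with $p$ at $x_0$.\<close>
lemma sublinear_tilt:
  assumes p: "sublinear p"
  shows "\<exists>q. sublinear q \<and> q \<le> p \<and> q (- x0) \<le> - p x0"
proof -
  define C where "C = {(x, s). \<exists>t\<ge>0. p (x + t *\<^sub>R x0) - t * p x0 \<le> s}"
  define q where "q = (\<lambda>x. Inf {s. (x, s) \<in> C})"
  have p_add: "p (x + y) \<le> p x + p y" for x y
    using p by (simp add: sublinear_def)
  have p_scale: "p (r *\<^sub>R x) = r * p x" if "0 \<le> r" for r x
    using p that by (simp add: sublinear_def)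
  have C_I: "(x, p (x + t *\<^sub>R x0) - t * p x0) \<in> C" if "0 \<le> t" for x t
    using that by (auto simp: C_def)
  have bdd: "bdd_below {s. (x, s) \<in> C}" for x
  proof (rule bdd_belowI)
    fix s assume "s \<in> {s. (x, s) \<in> C}"
    then obtain t where t: "0 \<le> t" "p (x + t *\<^sub>R x0) - t * p x0 \<le> s"
      by (auto simp: C_def)
    have "t * p x0 \<le> p (x + t *\<^sub>R x0) + p (- x)"
      using p_add[of "x + t *\<^sub>R x0" "- x"] p_scale[OF t(1), of x0] by (simp add: algebra_simps)
    then show "- p (- x) \<le> s" using t by simp
  qed
  have "sublinear q"
    unfolding q_def
  proof (rule sublinear_Inf[OF _ _ bdd])
    fix x y s t assume "(x, s) \<in> C" "(y, t) \<in> C"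
    then obtain a b where "0 \<le> a" "p (x + a *\<^sub>R x0) - a * p x0 \<le> s"
      and "0 \<le> b" "p (y + b *\<^sub>R x0) - b * p x0 \<le> t"
      by (auto simp: C_def)
    moreover have "p ((x + y) + (a + b) *\<^sub>R x0) \<le> p (x + a *\<^sub>R x0) + p (y + b *\<^sub>R x0)"
      using p_add[of "x + a *\<^sub>R x0" "y + b *\<^sub>R x0"] by (simp add: algebra_simps)
    ultimately show "(x + y, s + t) \<in> C"
      by (auto simp: C_def intro!: exI[of _ "a + b"] simp: algebra_simps)
  next
    fix r :: real and x t assume "(x, t) \<in> C" and r: "0 \<le> r"
    then obtain a where a: "0 \<le> a" "p (x + a *\<^sub>R x0) - a * p x0 \<le> t"
      by (auto simp: C_def)
    have "p (r *\<^sub>R x + (r * a) *\<^sub>R x0) = r * p (x + a *\<^sub>R x0)"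
      using p_scale[OF r, of "x + a *\<^sub>R x0"] by (simp add: algebra_simps)
    then show "(r *\<^sub>R x, r * t) \<in> C"
      using a r mult_left_mono[OF a(2) r]
      by (auto simp: C_def intro!: exI[of _ "r * a"] simp: algebra_simps)
  next
    fix x show "\<exists>t. (x, t) \<in> C" using C_I[of 0] by blast
  qed
  moreover have "q x \<le> p (x + t *\<^sub>R x0) - t * p x0" if "0 \<le> t" for x t
    unfolding q_def using C_I[OF that] bdd by (intro cInf_lower) auto
  \<comment> \<open>The parameter t = 0 gives q \<le> p; t = 1 at the point -x0 leaves p(0) - p(x0)
    with p(0) = 0.\<close>
  from this[of 0] this[of 1 "- x0"] have "q \<le> p" "q (- x0) \<le> - p x0"
    using sublinear_zero[OF p] by (auto simp: le_fun_def)
  ultimately show ?thesis by blast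
qed

lemma minimal_sublinear_linear:
  assumes p: "sublinear p" and minimal: "\<And>q. sublinear q \<Longrightarrow> q \<le> p \<Longrightarrow> q = p"
  shows "linear p"
proof -
  have p_add: "p (x + y) \<le> p x + p y" for x y
    using p by (simp add: sublinear_def)
  have p_scale: "p (r *\<^sub>R x) = r * p x" if "0 \<le> r" for r x
    using p that by (simp add: sublinear_def)
  have "p (- x) \<le> - p x" for x
    using sublinear_tilt[OF p, of x] minimal by blast
  then have p_minus: "p (- x) = - p x" for x
    using sublinear_minus[OF p, of x] by (intro antisym) auto
  show ?thesis
  proof (rule linearI)
    fix x y
    show "p (x + y) = p x + p y"
      using p_add[of x y] p_add[of "x + y" "- y"] by (simp add: p_minus)
  next
    fix r x
    show "p (r *\<^sub>R x) = r *\<^sub>R p x"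
      using p_scale[of r x] p_scale[of "- r" x] p_minus[of "r *\<^sub>R x"]
      by (cases "0 \<le> r") auto
  qed
qed

text \<open>Zorn's lemma for the reversed pointwise order. Every sublinear q \<le> p satisfies
  -p(-x) \<le> q(x), and this common lower bound keeps the infimum of a chain finite.\<close>

lemma ex_minimal_sublinear:
  assumes p: "sublinear p"
  shows "\<exists>m. sublinear m \<and> m \<le> p \<and> (\<forall>q. sublinear q \<longrightarrow> q \<le> m \<longrightarrow> q = m)"
proof -
  let ?A = "{q. sublinear q \<and> q \<le> p}" and ?P = "\<lambda>q q' :: 'a \<Rightarrow> real. q' \<le> q"
  have "\<exists>m\<in>?A. \<forall>a\<in>?A. ?P m a \<longrightarrow> a = m"
  proof (rule predicate_Zorn)
    show "partial_order_on ?A (relation_of ?P ?A)"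
      by (rule partial_order_on_relation_ofI) auto
  next
    fix K assume K: "K \<in> Chains (relation_of ?P ?A)"
    then have sub: "q \<in> ?A" if "q \<in> K" for q
      using that by (auto simp: Chains_def relation_of_def)
    have chain: "q \<le> q' \<or> q' \<le> q" if "q \<in> K" "q' \<in> K" for q q'
      using K that by (auto simp: Chains_def relation_of_def)
    show "\<exists>u\<in>?A. \<forall>a\<in>K. u \<le> a"
    proof (cases "K = {}")
      case True
      then show ?thesis using p by auto
    next
      case False
      define C where "C = {(x, s). \<exists>q\<in>K. q x \<le> s}"
      define u where "u = (\<lambda>x. Inf {s. (x, s) \<in> C})"
      have bdd: "bdd_below {s. (x, s) \<in> C}" for x
      proof (rule bdd_belowI)
        fix s assume "s \<in> {s. (x, s) \<in> C}"
        then obtain q where q: "q \<in> K" "q x \<le> s" by (auto simp: C_def)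
        then show "- p (- x) \<le> s"
          using sub[OF q(1)] sublinear_minus[of q x] le_funD[of q p "- x"] by simp
      qed
      have "sublinear u"
        unfolding u_def
      proof (rule sublinear_Inf[OF _ _ bdd])
        fix x y s t assume "(x, s) \<in> C" "(y, t) \<in> C"
        then obtain q q' where q: "q \<in> K" "q x \<le> s" "q' \<in> K" "q' y \<le> t"
          by (auto simp: C_def)
        \<comment> \<open>The cone is closed under addition because the smaller of two members of
          the chain serves at both points.\<close>
        then obtain m where "m \<in> K" "m \<le> q" "m \<le> q'"
          using chain by blast
        moreover have "m (x + y) \<le> m x + m y"
          using sub \<open>m \<in> K\<close> by (auto simp: sublinear_def)
        moreover have "m x \<le> q x" "m y \<le> q' y"
          using \<open>m \<le> q\<close> \<open>m \<le> q'\<close> by (auto simp: le_fun_def)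
        ultimately have "m (x + y) \<le> s + t"
          using q by linarith
        with \<open>m \<in> K\<close> show "(x + y, s + t) \<in> C"
          by (auto simp: C_def)
      next
        fix r :: real and x t assume "(x, t) \<in> C" and r: "0 \<le> r"
        then obtain q where q: "q \<in> K" "q x \<le> t"
          by (auto simp: C_def)
        then have "q (r *\<^sub>R x) \<le> r * t"
          using sub[OF q(1)] mult_left_mono[OF q(2) r] r by (simp add: sublinear_def)
        with q(1) show "(r *\<^sub>R x, r * t) \<in> C"
          by (auto simp: C_def)
      next
        fix x show "\<exists>t. (x, t) \<in> C" using False by (auto simp: C_def)
      qed
      moreover have u_le: "u \<le> q" if "q \<in> K" for q
        unfolding u_def using that bdd by (auto simp: le_fun_def C_def intro!: cInf_lower)
      moreover have "u \<le> p"
        using False sub order_trans[OF u_le] by blast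
      ultimately show ?thesis by blast
    qed
  qed
  then obtain m where m: "sublinear m" "m \<le> p"
    and "\<And>q. sublinear q \<Longrightarrow> q \<le> p \<Longrightarrow> q \<le> m \<Longrightarrow> q = m"
    by blast
  then show ?thesis
    using order_trans[OF _ m(2)] by blast
qed

text \<open>Instead of extending a functional from the line through x0, a minimal functional is
  taken below the tilt q: linearity turns q(-x0) \<le> -p(x0) into f(x0) \<ge> p(x0).\<close>

theorem Hahn_Banach_sublinear:
  assumes p: "sublinear p"
  obtains f where "linear f" "f \<le> p" "f x0 = p x0"
proof -
  obtain q where q: "sublinear q" "q \<le> p" "q (- x0) \<le> - p x0"
    using sublinear_tilt[OF p] by blast
  obtain f where f: "sublinear f" "f \<le> q" "\<forall>g. sublinear g \<longrightarrow> g \<le> f \<longrightarrow> g = f"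
    using ex_minimal_sublinear[OF q(1)] by blast
  have lin: "linear f"
    using f minimal_sublinear_linear by blast
  have "f \<le> p" using f(2) q(2) by (rule order_trans)
  moreover have "f x0 = p x0"
    using le_funD[OF f(2), of "- x0"] le_funD[OF \<open>f \<le> p\<close>, of x0] q(3) linear_neg[OF lin, of x0]
    by simp
  ultimately show ?thesis using lin that by blast
qed

section \<open>States of order-unit spaces\<close>

text \<open>The order-theoretic form of a state, which is how the majorant construction below
  delivers functionals. In what follows these states only index the coordinates of the Hilbert
  space.\<close>

definition ou_states :: "'a::ordered_real_vector \<Rightarrow> ('a \<Rightarrow> real) set" where
  "ou_states e = {\<mu>. linear \<mu> \<and> (\<forall>a\<ge>0. 0 \<le> \<mu> a) \<and> \<mu> e = 1}"

lemma order_unit_space_bound: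
  assumes "order_unit_space e"
  obtains m where "0 \<le> m" "- (m *\<^sub>R e) \<le> a" "a \<le> m *\<^sub>R e"
proof -
  obtain r s where rs: "a \<le> r *\<^sub>R e" "- a \<le> s *\<^sub>R e" and e: "0 \<le> e"
    using assms by (meson order_unit_space_def)
  define m where "m = max 0 (max r s)"
  have "r *\<^sub>R e \<le> m *\<^sub>R e" "s *\<^sub>R e \<le> m *\<^sub>R e"
    using e by (auto simp: m_def intro: scaleR_right_mono)
  then have "a \<le> m *\<^sub>R e" "- a \<le> m *\<^sub>R e"
    using rs by (blast intro: order_trans)+
  then show ?thesis
    using that[of m] by (simp add: m_def minus_le_iff)
qed

lemma order_unit_nonneg_scale:
  assumes "order_unit_space e" "e \<noteq> 0" "0 \<le> r *\<^sub>R e"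
  shows "0 \<le> r"
proof (rule ccontr)
  assume "\<not> 0 \<le> r"
  then have "e \<le> 0"
    using assms(3) scaleR_left_mono[of 0 "r *\<^sub>R e" "- inverse r"] by (simp add: neg_le_0_iff_le)
  with assms show False
    by (auto simp: order_unit_space_def)
qed

lemma ou_norm_nonneg: 
  assumes "order_unit_space e" shows "0 \<le> ou_norm e a"
  unfolding ou_norm_def
  by (rule cInf_greatest) (use order_unit_space_bound[OF assms, of a] in auto)

lemma ou_norm_le: "0 \<le> r \<Longrightarrow> - (r *\<^sub>R e) \<le> a \<Longrightarrow> a \<le> r *\<^sub>R e \<Longrightarrow> ou_norm e a \<le> r"
  unfolding ou_norm_def by (rule cInf_lower) (auto intro: bdd_belowI[of _ 0])

text \<open>The functionals $f$ with $f \ge 0$, $f \ge \phi$ and $f(e) = T$ are exactly the linear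
  functionals dominated by the infimum used here.\<close>
lemma positive_majorant:
  fixes e z :: "'a::ordered_real_vector"
  assumes ou: "order_unit_space e" and e0: "e \<noteq> 0"
    and lin: "linear \<phi>" and bound: "\<And>v r. 0 \<le> v \<Longrightarrow> v \<le> r *\<^sub>R e \<Longrightarrow> \<phi> v \<le> T * r"
  defines "S \<equiv> \<lambda>x. {r * T - \<phi> v | r v. 0 \<le> v \<and> x + v \<le> r *\<^sub>R e}"
  obtains f where "linear f" "\<And>v. 0 \<le> v \<Longrightarrow> 0 \<le> f v" "\<And>v. 0 \<le> v \<Longrightarrow> \<phi> v \<le> f v"
    "f e \<le> T" "f z = Inf (S z)"
proof -
  interpret \<phi>: linear \<phi> by (rule lin)
  define C where "C = {(x, t). t \<in> S x}"
  have bdd: "bdd_below {t. (x, t) \<in> C}" for x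
  proof -
    obtain m where m: "- (m *\<^sub>R e) \<le> x"
      using order_unit_space_bound[OF ou] by blast
    show ?thesis
    proof (rule bdd_belowI)
      fix t assume "t \<in> {t. (x, t) \<in> C}"
      then obtain r v where rv: "t = r * T - \<phi> v" "0 \<le> v" "x + v \<le> r *\<^sub>R e"
        by (auto simp: C_def S_def)
      \<comment> \<open>The hypothesis on \<phi> enters here: an admissible v lies between 0 and a
        multiple of e, so \<phi>(v) cannot push the infimum to minus infinity.\<close>
      have "- (m *\<^sub>R e) + v \<le> r *\<^sub>R e"
        using add_right_mono[OF m] rv(3) by (rule order_trans)
      then have "v \<le> (r + m) *\<^sub>R e"
        by (simp add: algebra_simps)
      from bound[OF rv(2) this] show "- (m * T) \<le> t"
        using rv(1) by (simp add: algebra_simps)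
    qed
  qed
  have C_I: "(x, r * T - \<phi> v) \<in> C" if "0 \<le> v" "x + v \<le> r *\<^sub>R e" for x r v
    using that by (auto simp: C_def S_def)
  have "sublinear (\<lambda>x. Inf {t. (x, t) \<in> C})"
  proof (rule sublinear_Inf[OF _ _ bdd])
    fix x y s t assume "(x, s) \<in> C" "(y, t) \<in> C"
    then obtain r v r' v' where v: "s = r * T - \<phi> v" "0 \<le> v" "x + v \<le> r *\<^sub>R e"
      and v': "t = r' * T - \<phi> v'" "0 \<le> v'" "y + v' \<le> r' *\<^sub>R e"
      by (auto simp: C_def S_def)
    have "s + t = (r + r') * T - \<phi> (v + v')"
      using v(1) v'(1) by (simp add: algebra_simps \<phi>.add)
    moreover have "x + y + (v + v') \<le> (r + r') *\<^sub>R e"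
      using add_mono[OF v(3) v'(3)] by (simp add: algebra_simps)
    ultimately show "(x + y, s + t) \<in> C"
      using C_I v(2) v'(2) by simp
  next
    fix k :: real and x t assume "(x, t) \<in> C" and k: "0 \<le> k"
    then obtain r v where v: "t = r * T - \<phi> v" "0 \<le> v" "x + v \<le> r *\<^sub>R e"
      by (auto simp: C_def S_def)
    have "k * t = k * r * T - \<phi> (k *\<^sub>R v)"
      by (simp add: v(1) right_diff_distrib \<phi>.scaleR)
    moreover have "k *\<^sub>R x + k *\<^sub>R v \<le> (k * r) *\<^sub>R e"
      using scaleR_left_mono[OF v(3) k] by (simp add: algebra_simps)
    ultimately show "(k *\<^sub>R x, k * t) \<in> C"
      using C_I k v(2) by (simp add: scaleR_nonneg_nonneg)
  next
    fix x
    obtain m where "x \<le> m *\<^sub>R e" using order_unit_space_bound[OF ou] by blast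
    then show "\<exists>t. (x, t) \<in> C" using C_I[of 0 x m] by auto
  qed
  then obtain f where f: "linear f" "f \<le> (\<lambda>x. Inf {t. (x, t) \<in> C})" "f z = Inf {t. (z, t) \<in> C}"
    by (rule Hahn_Banach_sublinear)
  interpret f: linear f by (rule f(1))
  have f_le: "f x \<le> r * T - \<phi> v" if "0 \<le> v" "x + v \<le> r *\<^sub>R e" for x r v
  proof -
    have "f x \<le> Inf {t. (x, t) \<in> C}" using f(2) by (simp add: le_fun_def)
    also have "\<dots> \<le> r * T - \<phi> v" using C_I[OF that] bdd by (intro cInf_lower) auto
    finally show ?thesis .
  qed
  show ?thesis
  proof (rule that[OF f(1)])
    \<comment> \<open>Each bound is one admissible choice in the infimum: at -v the vector 0 with r
      = 0 and then v itself with r = 0, and at e the vector 0 with r = 1.\<close>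
    show "0 \<le> f v" if "0 \<le> v" for v
      using f_le[of 0 "- v" 0] that by (simp add: f.neg)
    show "\<phi> v \<le> f v" if "0 \<le> v" for v
      using f_le[of v "- v" 0] that by (simp add: f.neg)
    show "f e \<le> T" using f_le[of 0 e 1] by simp
    show "f z = Inf (S z)" using f(3) by (simp add: C_def)
  qed
qed

text \<open>If a lies between -me and me, then f(a) lies between -m f(e) and m f(e). Hence a nonzero
  positive functional has f(e) > 0 and can be normalized to a state.\<close>

lemma positive_functional_zero:
  fixes f :: "'a::ordered_real_vector \<Rightarrow> real"
  assumes ou: "order_unit_space e" and lin: "linear f"
    and pos: "\<And>v. 0 \<le> v \<Longrightarrow> 0 \<le> f v" and "f e = 0"
  shows "f a = 0"
proof -
  interpret f: linear f by (rule lin)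
  obtain m where "- (m *\<^sub>R e) \<le> a" "a \<le> m *\<^sub>R e"
    using order_unit_space_bound[OF ou] by blast
  then have "0 \<le> f (a - - (m *\<^sub>R e))" "0 \<le> f (m *\<^sub>R e - a)"
    by (simp_all only: pos diff_ge_0_iff_ge)
  then have "0 \<le> f a + m * f e" "0 \<le> m * f e - f a"
    by (simp_all add: f.add f.diff f.neg f.scaleR)
  then show ?thesis using \<open>f e = 0\<close> by simp
qed

lemma normalized_state:
  assumes "linear f" "\<And>v. 0 \<le> v \<Longrightarrow> 0 \<le> f v" "f e = t" "0 < t"
  shows "(\<lambda>x. f x / t) \<in> ou_states e"
proof -
  interpret f: linear f by (rule assms(1))
  have "linear (\<lambda>x. f x / t)"
    by (rule linearI) (auto simp: f.add f.scaleR add_divide_distrib)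
  then show ?thesis using assms by (auto simp: ou_states_def)
qed

lemma ou_states_bounded:
  assumes ou: "order_unit_space e"
  shows "\<exists>m. \<forall>\<mu>\<in>ou_states e. \<bar>\<mu> a\<bar> \<le> m"
proof -
  obtain m where m: "- (m *\<^sub>R e) \<le> a" "a \<le> m *\<^sub>R e"
    using order_unit_space_bound[OF ou] by blast
  have "\<bar>\<mu> a\<bar> \<le> m" if \<mu>: "\<mu> \<in> ou_states e" for \<mu>
  proof -
    interpret \<mu>: linear \<mu> using \<mu> by (simp add: ou_states_def)
    have pos: "0 \<le> \<mu> v" if "0 \<le> v" for v
      using \<mu> that by (simp add: ou_states_def)
    have "0 \<le> \<mu> (a - - (m *\<^sub>R e))" "0 \<le> \<mu> (m *\<^sub>R e - a)"
      using m by (simp_all only: pos diff_ge_0_iff_ge)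
    then show ?thesis
      using \<mu> by (simp add: ou_states_def \<mu>.add \<mu>.neg \<mu>.diff \<mu>.scaleR abs_le_iff)
  qed
  then show ?thesis by blast
qed

text \<open>Separation from the positive cone. The Archimedean axiom turns the failure of a \<le> b
  into a gap r > 0 with a - b not below re, and a positive functional that attains at a - b the
  infimum of the s with a - b \<le> se has value at least r there.\<close>

lemma le_iff_ou_states:
  assumes ou: "order_unit_space e"
  shows "a \<le> b \<longleftrightarrow> (\<forall>\<mu>\<in>ou_states e. \<mu> a \<le> \<mu> b)"
proof
  assume "a \<le> b"
  then have "0 \<le> \<mu> (b - a)" if "\<mu> \<in> ou_states e" for \<mu>
    using that by (simp add: ou_states_def)
  then show "\<forall>\<mu>\<in>ou_states e. \<mu> a \<le> \<mu> b"
    by (simp add: ou_states_def linear_diff)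
next
  assume le: "\<forall>\<mu>\<in>ou_states e. \<mu> a \<le> \<mu> b"
  show "a \<le> b"
  proof (rule ccontr)
    assume "\<not> a \<le> b"
    then have "\<not> a - b \<le> 0" by simp
    then obtain r where r: "0 < r" "\<not> a - b \<le> r *\<^sub>R e"
      using ou unfolding order_unit_space_def by blast
    have e: "0 \<le> e" using ou by (simp add: order_unit_space_def)
    have e0: "e \<noteq> 0"
    proof
      assume "e = 0"
      obtain m where "a - b \<le> m *\<^sub>R e" using order_unit_space_bound[OF ou] by blast
      then show False using \<open>e = 0\<close> r(2) by simp
    qed
    \<comment> \<open>The odd shape is the set of \<open>positive_majorant\<close> for T = 1 and
      \<phi> = 0.\<close>
    let ?S = "\<lambda>x. {s * 1 - 0 | s v. 0 \<le> v \<and> x + v \<le> s *\<^sub>R e}"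
    obtain f where f: "linear f" "\<And>v. 0 \<le> v \<Longrightarrow> 0 \<le> f v" "f e \<le> 1" "f (a - b) = Inf (?S (a - b))"
    proof (rule positive_majorant[OF ou e0, of "\<lambda>_. 0" 1 "a - b"])
      show "linear (\<lambda>_::'a. 0::real)" by (simp add: linear_iff)
      show "0 \<le> 1 * s" if "0 \<le> v" "v \<le> s *\<^sub>R e" for v s
        using order_unit_nonneg_scale[OF ou e0 order_trans[OF that]] by simp
    qed (rule that)
    have "r \<le> Inf (?S (a - b))"
    proof (rule cInf_greatest)
      obtain m where "a - b \<le> m *\<^sub>R e" using order_unit_space_bound[OF ou] by blast
      then have "m * 1 - 0 \<in> ?S (a - b)"
        by (intro CollectI exI[of _ m] exI[of _ "0::'a"]) simp
      then show "?S (a - b) \<noteq> {}" by blast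
    next
      fix t assume "t \<in> ?S (a - b)"
      then obtain v where "0 \<le> v" "a - b + v \<le> t *\<^sub>R e" by auto
      moreover have "a - b \<le> a - b + v" using \<open>0 \<le> v\<close> by simp
      ultimately have "a - b \<le> t *\<^sub>R e" using order_trans by blast
      then have "\<not> t *\<^sub>R e \<le> r *\<^sub>R e" using r(2) order_trans by blast
      then show "r \<le> t" using scaleR_right_mono[OF _ e, of t r] by linarith
    qed
    then have pos: "0 < f (a - b)" using f(4) r by simp
    have "f e \<noteq> 0"
      using positive_functional_zero[OF ou f(1,2), of "a - b"] pos by linarith
    then have fe: "0 < f e" using f(2)[OF e] by simp
    from bspec[OF le normalized_state[OF f(1,2) refl fe]] have "f a \<le> f b"
      using fe by (simp add: divide_le_cancel)
    then show False
      using pos linear_diff[OF f(1), of a b] by simp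
  qed
qed

section \<open>The order-unit norm and the functionals that it bounds\<close>

lemma ou_norm_minus: "ou_norm e (- a) = ou_norm e a"
  unfolding ou_norm_def by (simp add: minus_le_iff conj_commute)

lemma ou_norm_add:
  assumes ou: "order_unit_space e"
  shows "ou_norm e (a + b) \<le> ou_norm e a + ou_norm e b"
proof -
  let ?N = "\<lambda>a. {r. 0 \<le> r \<and> - (r *\<^sub>R e) \<le> a \<and> a \<le> r *\<^sub>R e}"
  have ne: "?N a \<noteq> {}" for a
    using order_unit_space_bound[OF ou, of a] by blast
  have "ou_norm e (a + b) \<le> r + s" if "r \<in> ?N a" "s \<in> ?N b" for r s
  proof (rule ou_norm_le)
    show "- ((r + s) *\<^sub>R e) \<le> a + b" "a + b \<le> (r + s) *\<^sub>R e"
      using that add_mono[of "- (r *\<^sub>R e)" a "- (s *\<^sub>R e)" b] add_mono[of a "r *\<^sub>R e" b "s *\<^sub>R e"]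
      by (auto simp: algebra_simps)
  qed (use that in auto)
  then have "ou_norm e (a + b) - s \<le> ou_norm e a" if "s \<in> ?N b" for s
    unfolding ou_norm_def[of e a] using that ne by (intro cInf_greatest) (auto simp: algebra_simps)
  then have "ou_norm e (a + b) - ou_norm e a \<le> ou_norm e b"
    unfolding ou_norm_def[of e b] using ne by (intro cInf_greatest) (auto simp: algebra_simps)
  then show ?thesis by simp
qed

lemma ou_norm_scaleR_le:
  assumes ou: "order_unit_space e" and r: "0 \<le> r"
  shows "ou_norm e (r *\<^sub>R a) \<le> r * ou_norm e a"
proof (cases "r = 0")
  case True
  then show ?thesis using ou_norm_le[of 0 e 0] by simp
next
  case False
  let ?N = "{r. 0 \<le> r \<and> - (r *\<^sub>R e) \<le> a \<and> a \<le> r *\<^sub>R e}"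
  have "ou_norm e (r *\<^sub>R a) / r \<le> ou_norm e a"
    unfolding ou_norm_def[of e a]
  proof (rule cInf_greatest)
    show "?N \<noteq> {}" using order_unit_space_bound[OF ou, of a] by blast
  next
    fix s assume "s \<in> ?N"
    then have "ou_norm e (r *\<^sub>R a) \<le> r * s"
      using r scaleR_left_mono[of "- (s *\<^sub>R e)" a r] scaleR_left_mono[of a "s *\<^sub>R e" r]
      by (intro ou_norm_le) auto
    then show "ou_norm e (r *\<^sub>R a) / r \<le> s" using r False by (simp add: field_simps)
  qed
  then show ?thesis using r False by (simp add: field_simps)
qed

text \<open>A Jordan decomposition: f is a positive majorant of \<phi> and g = f - \<phi>. Since
  \<phi>(e) = 0, both take the same value t at e and are normalized by the same factor; t = 0 would
  make f and g vanish, and \<phi> with them.\<close>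

lemma states_difference:
  assumes ou: "order_unit_space e" and e0: "e \<noteq> 0"
    and lin: "linear \<phi>" and bound: "\<And>v. \<phi> v \<le> K * ou_norm e v" and K: "0 \<le> K"
    and "\<phi> e = 0" "\<phi> a \<noteq> 0"
  obtains t \<mu> \<nu> where "0 < t" "\<mu> \<in> ou_states e" "\<nu> \<in> ou_states e" "\<And>x. \<phi> x = t * (\<mu> x - \<nu> x)"
proof -
  have K_bound: "\<phi> v \<le> K * r" if "0 \<le> v" "v \<le> r *\<^sub>R e" for v r
  proof -
    have re: "0 \<le> r *\<^sub>R e" using that by (rule order_trans)
    then have "- (r *\<^sub>R e) \<le> 0" by (simp only: neg_le_0_iff_le)
    then have "ou_norm e v \<le> r"
      using that order_unit_nonneg_scale[OF ou e0 re] by (blast intro: ou_norm_le order_trans)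
    from order_trans[OF bound mult_left_mono[OF this K]] show ?thesis .
  qed
  \<comment> \<open>Any majorant will do, so the point at which the infimum is attained is chosen
    arbitrarily as 0.\<close>
  obtain f where f: "linear f" "\<And>v. 0 \<le> v \<Longrightarrow> 0 \<le> f v" "\<And>v. 0 \<le> v \<Longrightarrow> \<phi> v \<le> f v"
  proof (rule positive_majorant[OF ou e0 lin K_bound, where z = 0])
    fix f assume "linear f" "\<And>v. 0 \<le> v \<Longrightarrow> 0 \<le> f v" "\<And>v. 0 \<le> v \<Longrightarrow> \<phi> v \<le> f v"
    then show thesis by (rule that)
  qed
  define g where "g = (\<lambda>x. f x - \<phi> x)"
  have g: "linear g" "\<And>v. 0 \<le> v \<Longrightarrow> 0 \<le> g v"
    unfolding g_def using f linear_compose_sub[OF f(1) lin] by simp_all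
  have fg: "g e = f e" by (simp add: g_def \<open>\<phi> e = 0\<close>)
  have "0 \<le> f e" using f(2) ou by (simp add: order_unit_space_def)
  moreover have "f e \<noteq> 0"
  proof
    assume "f e = 0"
    then have "f a = 0" "g a = 0"
      using positive_functional_zero[OF ou f(1,2), of a] positive_functional_zero[OF ou g, of a] fg
      by simp_all
    then show False using \<open>\<phi> a \<noteq> 0\<close> by (simp add: g_def)
  qed
  ultimately have t: "0 < f e" by simp
  show ?thesis
  proof (rule that[OF t])
    show "(\<lambda>x. f x / f e) \<in> ou_states e" "(\<lambda>x. g x / f e) \<in> ou_states e"
      using normalized_state[OF f(1,2) refl t] normalized_state[OF g fg t] by auto
    show "\<phi> x = f e * (f x / f e - g x / f e)" for x
      using t by (simp add: g_def field_simps)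
  qed
qed

lemma lower_semicontinuous_separation:
  fixes e :: "'a::ordered_real_vector"
  assumes ou: "order_unit_space e" and L: "seminorm L" and Le: "L e = 0"
    and lsc: "lower_semicontinuous e L" and c: "0 < c" "c < L a"
  obtains t \<mu> \<nu> where "0 \<le> t" "\<mu> \<in> ou_states e" "\<nu> \<in> ou_states e"
    "\<And>x. t * \<bar>\<mu> x - \<nu> x\<bar> \<le> L x" "c \<le> t * (\<mu> a - \<nu> a)"
proof -
  have L_nonneg: "0 \<le> L x" and L_add: "L (x + y) \<le> L x + L y"
    and L_scale: "L (r *\<^sub>R x) = \<bar>r\<bar> * L x" for x y r
    using L by (auto simp: seminorm_def)
  have L0: "L 0 = 0" using L_scale[of 0 0] by simp
  have Lm: "L (- x) = L x" for x using L_scale[of "-1" x] by simp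
  have e0: "e \<noteq> 0"
  proof
    assume "e = 0"
    obtain m where "- (m *\<^sub>R e) \<le> a" "a \<le> m *\<^sub>R e"
      using order_unit_space_bound[OF ou] by blast
    then have "a = 0" using \<open>e = 0\<close> by simp
    then show False using c L0 by simp
  qed
  \<comment> \<open>Semi-continuity with tolerance L(a) - c gives L > c on a whole ball around
    a.\<close>
  have "\<exists>\<delta>>0. \<forall>b. ou_norm e (b - a) < \<delta> \<longrightarrow> L a - (L a - c) < L b"
    using lsc c(2) unfolding lower_semicontinuous_def by (meson diff_gt_0_iff_gt)
  then obtain \<delta> where \<delta>: "0 < \<delta>" "\<And>b. ou_norm e (b - a) < \<delta> \<Longrightarrow> c < L b"
    by fastforce
  \<comment> \<open>Chosen so that K \<delta> = c: in the infimum at a, a point at distance at least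
    \<delta> costs c through the norm term, and a nearer one through L.\<close>
  define K where "K = c / \<delta>"
  have K: "0 < K" using \<delta> c by (simp add: K_def)
  \<comment> \<open>The infimal convolution of $L$ and $K$ times the norm lies below both seminorms, and the choice
    of $K$ keeps its value at $a$ above $c$.\<close>
  define C where "C = {(b, s). \<exists>x. L x + K * ou_norm e (x - b) \<le> s}"
  define q where "q = (\<lambda>x. Inf {t. (x, t) \<in> C})"
  have C_nonneg: "0 \<le> s" if bs: "(b, s) \<in> C" for b s
  proof -
    obtain x where "L x + K * ou_norm e (x - b) \<le> s"
      using bs by (auto simp: C_def)
    moreover have "0 \<le> K * ou_norm e (x - b)" using K ou_norm_nonneg[OF ou] by simp
    ultimately show ?thesis using L_nonneg[of x] by linarith
  qed
  then have bdd: "bdd_below {t. (x, t) \<in> C}" for x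
    by (auto intro: bdd_belowI[of _ 0])
  have "sublinear q"
    unfolding q_def
  proof (rule sublinear_Inf[OF _ _ bdd])
    fix x y s t assume "(x, s) \<in> C" "(y, t) \<in> C"
    then obtain x' y' where xy: "L x' + K * ou_norm e (x' - x) \<le> s"
      "L y' + K * ou_norm e (y' - y) \<le> t" by (auto simp: C_def)
    have "ou_norm e ((x' + y') - (x + y)) \<le> ou_norm e (x' - x) + ou_norm e (y' - y)"
      using ou_norm_add[OF ou, of "x' - x" "y' - y"] by (simp add: algebra_simps)
    then have "K * ou_norm e ((x' + y') - (x + y)) \<le> K * ou_norm e (x' - x) + K * ou_norm e (y' - y)"
      using K by (metis distrib_left less_imp_le mult_left_mono)
    then have "L (x' + y') + K * ou_norm e ((x' + y') - (x + y)) \<le> s + t"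
      using xy L_add[of x' y'] by linarith
    then show "(x + y, s + t) \<in> C" by (auto simp: C_def)
  next
    fix r :: real and x t assume "(x, t) \<in> C" and r: "0 \<le> r"
    then obtain x' where x': "L x' + K * ou_norm e (x' - x) \<le> t" by (auto simp: C_def)
    have "ou_norm e (r *\<^sub>R x' - r *\<^sub>R x) \<le> r * ou_norm e (x' - x)"
      using ou_norm_scaleR_le[OF ou r, of "x' - x"] by (simp add: scaleR_diff_right)
    then have "K * ou_norm e (r *\<^sub>R x' - r *\<^sub>R x) \<le> r * (K * ou_norm e (x' - x))"
      using K by (simp add: mult.left_commute)
    then have "L (r *\<^sub>R x') + K * ou_norm e (r *\<^sub>R x' - r *\<^sub>R x) \<le> r * t"
      using mult_left_mono[OF x' r] r by (simp add: L_scale distrib_left)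
    then show "(r *\<^sub>R x, r * t) \<in> C" by (auto simp: C_def)
  next
    fix x show "\<exists>t. (x, t) \<in> C" by (auto simp: C_def)
  qed
  then obtain \<phi> where \<phi>: "linear \<phi>" "\<phi> \<le> q" "\<phi> a = q a"
    by (rule Hahn_Banach_sublinear)
  interpret \<phi>: linear \<phi> by (rule \<phi>(1))
  have \<phi>_le: "\<phi> b \<le> L x + K * ou_norm e (x - b)" for b x
  proof -
    have "\<phi> b \<le> q b" using \<phi>(2) by (simp add: le_fun_def)
    also have "\<dots> \<le> L x + K * ou_norm e (x - b)"
      unfolding q_def using bdd by (intro cInf_lower) (auto simp: C_def)
    finally show ?thesis .
  qed
  have n0: "ou_norm e 0 = 0"
    using ou_norm_le[of 0 e 0] ou_norm_nonneg[OF ou, of 0] by simp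
  \<comment> \<open>Approximating a vector by itself leaves only L, approximating it by 0 leaves
    only the norm term; so \<phi> obeys both bounds.\<close>
  have \<phi>_L: "\<bar>\<phi> x\<bar> \<le> L x" for x
    using \<phi>_le[of x x] \<phi>_le[of "- x" "- x"] by (simp add: n0 Lm \<phi>.neg)
  have \<phi>_K: "\<phi> x \<le> K * ou_norm e x" for x
    using \<phi>_le[of x 0] by (simp add: L0 ou_norm_minus)
  have "c \<le> q a"
    unfolding q_def
  proof (rule cInf_greatest)
    show "{t. (a, t) \<in> C} \<noteq> {}" by (auto simp: C_def)
  next
    fix s assume "s \<in> {t. (a, t) \<in> C}"
    then obtain x where x: "L x + K * ou_norm e (x - a) \<le> s" by (auto simp: C_def)
    show "c \<le> s"
    proof (cases "ou_norm e (x - a) < \<delta>")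
      case True
      then show ?thesis
        using \<delta>(2)[OF True] x mult_nonneg_nonneg[OF less_imp_le[OF K] ou_norm_nonneg[OF ou, of "x - a"]]
        by linarith
    next
      case False
      then have "K * \<delta> \<le> K * ou_norm e (x - a)" using K by simp
      then show ?thesis using x \<delta>(1) L_nonneg[of x] by (simp add: K_def)
    qed
  qed
  then have c_le: "c \<le> \<phi> a" using \<phi>(3) by simp
  have "\<phi> e = 0" using \<phi>_L[of e] Le by simp
  moreover have "\<phi> a \<noteq> 0" using c_le c by simp
  ultimately obtain t \<mu> \<nu> where *: "0 < t" "\<mu> \<in> ou_states e" "\<nu> \<in> ou_states e"
    "\<And>x. \<phi> x = t * (\<mu> x - \<nu> x)"
    by (rule states_difference[OF ou e0 \<phi>(1) \<phi>_K less_imp_le[OF K]]) (rule that)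
  show ?thesis
  proof (rule that[of t, OF _ *(2,3)])
    show "t * \<bar>\<mu> x - \<nu> x\<bar> \<le> L x" for x
      using \<phi>_L[of x] *(1,4) by (simp add: abs_mult)
  qed (use * c_le in auto)
qed

section \<open>Square-summable families\<close>

text \<open>The index set need not be a whole type. Vectors are total functions vanishing off I, so
  sums run over the type and equality of functions is equality of vectors.\<close>

definition l2 :: "'i set \<Rightarrow> ('i \<Rightarrow> complex) hilbert" where
  "l2 I = \<lparr>carrier = {f. (\<forall>i. i \<notin> I \<longrightarrow> f i = 0) \<and> (\<lambda>i. (cmod (f i))\<^sup>2) summable_on UNIV},
     mult = (\<lambda>f g i. f i * g i), one = (\<lambda>i. 1), zero = (\<lambda>i. 0), add = (\<lambda>f g i. f i + g i),
     smult = (\<lambda>c f i. c * f i), cinner = (\<lambda>f g. \<Sum>\<^sub>\<infinity>i. f i * cnj (g i))\<rparr>"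

lemma l2_simps [simp]:
  "\<zero>\<^bsub>l2 I\<^esub> = (\<lambda>i. 0)" "f \<oplus>\<^bsub>l2 I\<^esub> g = (\<lambda>i. f i + g i)" "c \<odot>\<^bsub>l2 I\<^esub> f = (\<lambda>i. c * f i)"
  "cinner (l2 I) f g = (\<Sum>\<^sub>\<infinity>i. f i * cnj (g i))"
  by (simp_all add: l2_def)

lemma l2_carrier:
  "f \<in> carrier (l2 I) \<longleftrightarrow> (\<forall>i. i \<notin> I \<longrightarrow> f i = 0) \<and> (\<lambda>i. (cmod (f i))\<^sup>2) summable_on UNIV"
  by (simp add: l2_def)

lemma ring_of_type_algebra_simps [simp]:
  "carrier ring_of_type_algebra = UNIV" "a \<otimes>\<^bsub>ring_of_type_algebra\<^esub> b = a * b"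
  "a \<oplus>\<^bsub>ring_of_type_algebra\<^esub> b = a + b" "\<one>\<^bsub>ring_of_type_algebra\<^esub> = 1"
  "\<zero>\<^bsub>ring_of_type_algebra\<^esub> = 0"
  by (simp_all add: ring_of_type_algebra_def)

lemma l2_summable_product:
  assumes "f \<in> carrier (l2 I)" "g \<in> carrier (l2 I)"
  shows "(\<lambda>i. f i * cnj (g i)) summable_on UNIV"
proof (rule abs_summable_summable, rule Infinite_Sum.abs_summable_on_comparison_test')
  show "(\<lambda>i. (cmod (f i))\<^sup>2 + (cmod (g i))\<^sup>2) summable_on UNIV"
    using assms by (intro summable_on_add) (auto simp: l2_carrier)
  fix i
  have "2 * (cmod (f i) * cmod (g i)) \<le> (cmod (f i))\<^sup>2 + (cmod (g i))\<^sup>2"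
    using sum_squares_bound[of "cmod (f i)" "cmod (g i)"] by simp
  moreover have "0 \<le> cmod (f i) * cmod (g i)" by simp
  ultimately have "cmod (f i) * cmod (g i) \<le> (cmod (f i))\<^sup>2 + (cmod (g i))\<^sup>2"
    by linarith
  then show "cmod (f i * cnj (g i)) \<le> (cmod (f i))\<^sup>2 + (cmod (g i))\<^sup>2"
    by (simp add: norm_mult)
qed

text \<open>Comparison with the reindexed sum of squares of f. The bijection is there for weighted
  flips; with the identity it handles scalar multiples, truncations and multiplication
  operators.\<close>

lemma l2_bounded_mult:
  assumes f: "f \<in> carrier (l2 I)" and "bij \<sigma>" and "\<And>i. i \<notin> I \<Longrightarrow> g i = 0"
    and g: "\<And>i. i \<in> I \<Longrightarrow> cmod (g i) \<le> K * cmod (f (\<sigma> i))"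
  shows "g \<in> carrier (l2 I)"
proof -
  have "(\<lambda>i. (cmod (f (\<sigma> i)))\<^sup>2) summable_on UNIV"
    using f summable_on_reindex_bij_betw[OF \<open>bij \<sigma>\<close>, of "\<lambda>i. (cmod (f i))\<^sup>2"] by (simp add: l2_carrier)
  then have "(\<lambda>i. K\<^sup>2 * (cmod (f (\<sigma> i)))\<^sup>2) summable_on UNIV"
    by (rule summable_on_cmult_right)
  then have "(\<lambda>i. (cmod (g i))\<^sup>2) summable_on UNIV"
  proof (rule summable_on_comparison_test)
    fix i show "(cmod (g i))\<^sup>2 \<le> K\<^sup>2 * (cmod (f (\<sigma> i)))\<^sup>2"
      using power_mono[OF g, of i 2] assms(3) by (cases "i \<in> I") (auto simp: power_mult_distrib)
  qed auto
  then show ?thesis using assms(3) by (simp add: l2_carrier)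
qed

lemma l2_zero: "(\<lambda>i. 0) \<in> carrier (l2 I)"
  by (simp add: l2_carrier)

lemma l2_smult: "f \<in> carrier (l2 I) \<Longrightarrow> (\<lambda>i. c * f i) \<in> carrier (l2 I)"
  by (rule l2_bounded_mult[where \<sigma> = id and K = "cmod c"]) (auto simp: norm_mult l2_carrier)

lemma l2_add:
  assumes "f \<in> carrier (l2 I)" "g \<in> carrier (l2 I)"
  shows "(\<lambda>i. f i + g i) \<in> carrier (l2 I)"
proof -
  have "(\<lambda>i. 2 * ((cmod (f i))\<^sup>2 + (cmod (g i))\<^sup>2)) summable_on UNIV"
    using assms by (intro summable_on_cmult_right summable_on_add) (auto simp: l2_carrier)
  then have "(\<lambda>i. (cmod (f i + g i))\<^sup>2) summable_on UNIV"
  proof (rule summable_on_comparison_test)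
    fix i
    have "(cmod (f i + g i))\<^sup>2 \<le> (cmod (f i) + cmod (g i))\<^sup>2"
      by (intro power_mono norm_triangle_ineq) simp
    then show "(cmod (f i + g i))\<^sup>2 \<le> 2 * ((cmod (f i))\<^sup>2 + (cmod (g i))\<^sup>2)"
      using sum_squares_bound[of "cmod (f i)" "cmod (g i)"] by (simp add: power2_sum)
  qed auto
  then show ?thesis using assms by (simp add: l2_carrier)
qed

lemma l2_diff:
  assumes "f \<in> carrier (l2 I)" "g \<in> carrier (l2 I)"
  shows "(\<lambda>i. f i - g i) \<in> carrier (l2 I)"
  using l2_add[OF assms(1) l2_smult[OF assms(2), of "-1"]] by simp

lemma module_l2: "module (ring_of_type_algebra :: complex ring) (l2 I)"
proof (rule moduleI)
  show "cring (ring_of_type_algebra :: complex ring)" by (rule cring_from_type_algebra)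
  show "abelian_group (l2 I)"
  proof (rule abelian_groupI)
    fix x assume "x \<in> carrier (l2 I)"
    then show "\<exists>y\<in>carrier (l2 I). y \<oplus>\<^bsub>l2 I\<^esub> x = \<zero>\<^bsub>l2 I\<^esub>"
      by (intro bexI[of _ "\<lambda>i. -1 * x i"] l2_smult) auto
  qed (auto simp: l2_add l2_zero algebra_simps)
qed (auto simp: l2_smult algebra_simps)

lemma l2_minus:
  assumes "f \<in> carrier (l2 I)" "g \<in> carrier (l2 I)"
  shows "f \<ominus>\<^bsub>l2 I\<^esub> g = (\<lambda>i. f i - g i)"
proof -
  interpret module "ring_of_type_algebra :: complex ring" "l2 I" by (rule module_l2)
  have "\<ominus>\<^bsub>l2 I\<^esub> g = (\<lambda>i. -1 * g i)"
    by (rule M.minus_equality) (use assms l2_smult[of g I "-1"] in auto)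
  then show ?thesis by (simp add: a_minus_def)
qed

lemma l2_cinner_self:
  assumes "f \<in> carrier (l2 I)"
  shows "cinner (l2 I) f f = of_real (\<Sum>\<^sub>\<infinity>i. (cmod (f i))\<^sup>2)"
proof -
  have "((\<lambda>i. (cmod (f i))\<^sup>2) has_sum (\<Sum>\<^sub>\<infinity>i. (cmod (f i))\<^sup>2)) UNIV"
    using assms by (simp add: l2_carrier)
  then have "((\<lambda>i. of_real ((cmod (f i))\<^sup>2)) has_sum complex_of_real (\<Sum>\<^sub>\<infinity>i. (cmod (f i))\<^sup>2)) UNIV"
    by (rule has_sum_of_real)
  then have "((\<lambda>i. f i * cnj (f i)) has_sum complex_of_real (\<Sum>\<^sub>\<infinity>i. (cmod (f i))\<^sup>2)) UNIV"
    by (simp only: complex_norm_square)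
  then show ?thesis by (simp add: infsumI)
qed

lemma hnorm_l2:
  assumes "f \<in> carrier (l2 I)"
  shows "hnorm (l2 I) f = sqrt (\<Sum>\<^sub>\<infinity>i. (cmod (f i))\<^sup>2)"
  using l2_cinner_self[OF assms] by (simp add: hnorm_def)

lemma hnorm_l2_nonneg: "f \<in> carrier (l2 I) \<Longrightarrow> 0 \<le> hnorm (l2 I) f"
  by (simp add: hnorm_l2 infsum_nonneg)

text \<open>A bound on finite partial sums yields membership and the norm estimate together. It
  serves both for limits of Cauchy sequences and for images under bounded operators.\<close>

lemma l2_bounded_partial_sums:
  assumes "\<And>i. i \<notin> I \<Longrightarrow> f i = 0" and B: "0 \<le> B"
    and sums: "\<And>F. finite F \<Longrightarrow> (\<Sum>i\<in>F. (cmod (f i))\<^sup>2) \<le> B\<^sup>2"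
  shows "f \<in> carrier (l2 I)" "hnorm (l2 I) f \<le> B"
proof -
  have summable: "(\<lambda>i. (cmod (f i))\<^sup>2) summable_on UNIV"
    by (rule nonneg_bdd_above_summable_on) (use sums in \<open>auto intro!: bdd_aboveI\<close>)
  then show f: "f \<in> carrier (l2 I)" using assms(1) by (simp add: l2_carrier)
  have "(\<Sum>\<^sub>\<infinity>i. (cmod (f i))\<^sup>2) \<le> B\<^sup>2"
    using summable sums by (rule infsum_le_finite_sums)
  then show "hnorm (l2 I) f \<le> B"
    using B f by (auto simp: hnorm_l2 intro: real_le_lsqrt infsum_nonneg)
qed

lemma l2_partial_sum_le:
  assumes "f \<in> carrier (l2 I)" "finite F"
  shows "(\<Sum>i\<in>F. (cmod (f i))\<^sup>2) \<le> (hnorm (l2 I) f)\<^sup>2"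
proof -
  have "(\<Sum>i\<in>F. (cmod (f i))\<^sup>2) \<le> (\<Sum>\<^sub>\<infinity>i. (cmod (f i))\<^sup>2)"
    using assms by (intro finite_sum_le_infsum) (auto simp: l2_carrier)
  then show ?thesis using assms by (simp add: hnorm_l2 infsum_nonneg)
qed

lemma l2_component_le:
  assumes "f \<in> carrier (l2 I)"
  shows "cmod (f i) \<le> hnorm (l2 I) f"
  using l2_partial_sum_le[OF assms, of "{i}"] hnorm_l2_nonneg[OF assms] by (auto intro: power2_le_imp_le)

lemma l2_complete:
  assumes s: "\<And>n. s n \<in> carrier (l2 I)"
    and Cauchy: "\<forall>\<epsilon>>0. \<exists>N. \<forall>m\<ge>N. \<forall>n\<ge>N. hnorm (l2 I) (s m \<ominus>\<^bsub>l2 I\<^esub> s n) < \<epsilon>"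
  shows "\<exists>x\<in>carrier (l2 I). (\<lambda>n. hnorm (l2 I) (s n \<ominus>\<^bsub>l2 I\<^esub> x)) \<longlonglongrightarrow> 0"
proof -
  have diff: "(\<lambda>i. s m i - s n i) \<in> carrier (l2 I)" for m n
    using s by (intro l2_diff)
  have Cauchy': "\<exists>N. \<forall>m\<ge>N. \<forall>n\<ge>N. hnorm (l2 I) (\<lambda>i. s m i - s n i) < \<epsilon>" if "0 < \<epsilon>" for \<epsilon>
    using Cauchy that by (simp add: l2_minus s)
  have "convergent (\<lambda>n. s n i)" for i
  proof (rule Cauchy_convergent, rule metric_CauchyI)
    fix \<epsilon> :: real assume "0 < \<epsilon>"
    then obtain N where "\<forall>m\<ge>N. \<forall>n\<ge>N. hnorm (l2 I) (\<lambda>i. s m i - s n i) < \<epsilon>"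
      using Cauchy' by blast
    then show "\<exists>N. \<forall>m\<ge>N. \<forall>n\<ge>N. dist (s m i) (s n i) < \<epsilon>"
      unfolding dist_norm using le_less_trans[OF l2_component_le[OF diff]] by blast
  qed
  then obtain x where x: "\<And>i. (\<lambda>n. s n i) \<longlonglongrightarrow> x i"
    unfolding convergent_def by metis
  have x_outside: "x i = 0" if "i \<notin> I" for i
    using x[of i] s that by (simp add: l2_carrier LIMSEQ_const_iff)
  have close: "\<exists>N. \<forall>m\<ge>N. (\<lambda>i. s m i - x i) \<in> carrier (l2 I) \<and> hnorm (l2 I) (\<lambda>i. s m i - x i) \<le> \<epsilon>"
    if \<epsilon>: "0 < \<epsilon>" for \<epsilon>
  proof -
    obtain N where N: "\<And>m n. m \<ge> N \<Longrightarrow> n \<ge> N \<Longrightarrow> hnorm (l2 I) (\<lambda>i. s m i - s n i) < \<epsilon>"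
      using Cauchy'[OF \<epsilon>] by blast
    \<comment> \<open>On a fixed finite set the Cauchy estimate survives the coordinatewise limit in
      n; only afterwards does the set grow.\<close>
    have sums: "(\<Sum>i\<in>F. (cmod (s m i - x i))\<^sup>2) \<le> \<epsilon>\<^sup>2" if "m \<ge> N" "finite F" for m F
    proof (rule LIMSEQ_le_const2)
      show "(\<lambda>n. \<Sum>i\<in>F. (cmod (s m i - s n i))\<^sup>2) \<longlonglongrightarrow> (\<Sum>i\<in>F. (cmod (s m i - x i))\<^sup>2)"
        by (intro tendsto_intros x)
      have "(\<Sum>i\<in>F. (cmod (s m i - s n i))\<^sup>2) \<le> \<epsilon>\<^sup>2" if "n \<ge> N" for n
        using l2_partial_sum_le[OF diff[of m n] \<open>finite F\<close>]
          power_mono[OF less_imp_le[OF N[OF \<open>m \<ge> N\<close> that]] hnorm_l2_nonneg[OF diff], of 2]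
        by linarith
      then show "\<exists>N. \<forall>n\<ge>N. (\<Sum>i\<in>F. (cmod (s m i - s n i))\<^sup>2) \<le> \<epsilon>\<^sup>2" by blast
    qed
    have "s m i - x i = 0" if "i \<notin> I" for m i
      using that s x_outside by (simp add: l2_carrier)
    from l2_bounded_partial_sums[OF this less_imp_le[OF \<epsilon>] sums] show ?thesis by blast
  qed
  \<comment> \<open>A single member of the sequence at finite distance suffices: the limit is s N
    minus a vector of the space.\<close>
  obtain N where "(\<lambda>i. s N i - x i) \<in> carrier (l2 I)"
    using close[of 1] by auto
  from l2_diff[OF s[of N] this] have x_mem: "x \<in> carrier (l2 I)" by simp
  moreover have "(\<lambda>n. hnorm (l2 I) (s n \<ominus>\<^bsub>l2 I\<^esub> x)) \<longlonglongrightarrow> 0"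
  proof (rule LIMSEQ_I)
    fix \<epsilon> :: real assume \<epsilon>: "0 < \<epsilon>"
    then obtain N where N: "\<And>m. m \<ge> N \<Longrightarrow> hnorm (l2 I) (\<lambda>i. s m i - x i) \<le> \<epsilon> / 2"
      using close[of "\<epsilon> / 2"] by auto
    have "norm (hnorm (l2 I) (s n \<ominus>\<^bsub>l2 I\<^esub> x) - 0) < \<epsilon>" if "n \<ge> N" for n
      using N[OF that] \<epsilon> hnorm_l2_nonneg[OF l2_diff[OF s x_mem], of n] by (simp add: l2_minus s x_mem)
    then show "\<exists>N. \<forall>n\<ge>N. norm (hnorm (l2 I) (s n \<ominus>\<^bsub>l2 I\<^esub> x) - 0) < \<epsilon>"
      by blast
  qed
  ultimately show ?thesis by blast
qed

lemma complex_hilbert_space_l2: "complex_hilbert_space (l2 I)"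
proof (rule complex_hilbert_space.intro[OF module_l2], unfold_locales)
  fix x y z :: "'a \<Rightarrow> complex" and c
  assume x: "x \<in> carrier (l2 I)" and y: "y \<in> carrier (l2 I)"
  show "cinner (l2 I) y x = cnj (cinner (l2 I) x y)"
    by (simp add: mult.commute flip: infsum_cnj)
  show "cinner (l2 I) (c \<odot>\<^bsub>l2 I\<^esub> x) y = c * cinner (l2 I) x y"
    by (simp add: mult.assoc infsum_cmult_right')
  assume "z \<in> carrier (l2 I)"
  then show "cinner (l2 I) (x \<oplus>\<^bsub>l2 I\<^esub> y) z = cinner (l2 I) x z + cinner (l2 I) y z"
    using x y by (simp add: distrib_right infsum_add l2_summable_product)
next
  fix x :: "'a \<Rightarrow> complex" assume x: "x \<in> carrier (l2 I)"
  show "cinner (l2 I) x x \<in> \<real>\<^sub>\<ge>\<^sub>0"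
    unfolding l2_cinner_self[OF x] by (simp add: infsum_nonneg)
  assume "cinner (l2 I) x x = 0"
  then have "hnorm (l2 I) x = 0" by (simp add: hnorm_def)
  then have "x i = 0" for i using l2_component_le[OF x, of i] by simp
  then show "x = \<zero>\<^bsub>l2 I\<^esub>" by auto
qed (rule l2_complete)

section \<open>Weighted flips: domain, self-adjointness, norm and order\<close>

text \<open>With an involution $\sigma$, this covers both the action of $A$ ($\sigma$ the identity) and the
  flip operators $D$ and $[D, a]$.\<close>
definition wop :: "'i set \<Rightarrow> ('i \<Rightarrow> complex) \<Rightarrow> ('i \<Rightarrow> 'i) \<Rightarrow> ('i \<Rightarrow> complex) \<Rightarrow> 'i \<Rightarrow> complex" where
  "wop I \<phi> \<sigma> = (\<lambda>f\<in>carrier (l2 I). \<lambda>i. \<phi> i * f (\<sigma> i))"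

text \<open>The maximal domain; with a smaller one the operator could be symmetric without being
  self-adjoint.\<close>

definition wop_domain :: "'i set \<Rightarrow> ('i \<Rightarrow> complex) \<Rightarrow> ('i \<Rightarrow> 'i) \<Rightarrow> ('i \<Rightarrow> complex) set" where
  "wop_domain I \<phi> \<sigma> = {f \<in> carrier (l2 I). (\<lambda>i. \<phi> i * f (\<sigma> i)) \<in> carrier (l2 I)}"

definition unit_vec :: "'i \<Rightarrow> 'i \<Rightarrow> complex" where
  "unit_vec j = (\<lambda>i. if i = j then 1 else 0)"

lemma l2_finite_support:
  assumes "\<And>i. i \<notin> I \<Longrightarrow> f i = 0" "finite {i. f i \<noteq> 0}"
  shows "f \<in> carrier (l2 I)"
proof -
  have "(\<lambda>i. (cmod (f i))\<^sup>2) summable_on UNIV \<longleftrightarrow> (\<lambda>i. (cmod (f i))\<^sup>2) summable_on {i. f i \<noteq> 0}"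
    by (rule summable_on_cong_neutral) auto
  then show ?thesis using assms by (simp add: l2_carrier)
qed

lemma unit_vec_l2: "j \<in> I \<Longrightarrow> unit_vec j \<in> carrier (l2 I)"
  by (rule l2_finite_support) (auto simp: unit_vec_def)

lemma infsum_singleton_support:
  fixes f :: "'i \<Rightarrow> 'b::{comm_monoid_add, t2_space}"
  assumes "\<And>i. i \<noteq> j \<Longrightarrow> f i = 0"
  shows "(\<Sum>\<^sub>\<infinity>i. f i) = f j"
proof -
  have "infsum f UNIV = infsum f {j}"
    by (rule infsum_cong_neutral) (use assms in auto)
  then show ?thesis by simp
qed

lemma hnorm_unit_vec: "j \<in> I \<Longrightarrow> hnorm (l2 I) (\<lambda>i. c * unit_vec j i) = cmod c"
  using infsum_singleton_support[of j "\<lambda>i. (cmod (c * unit_vec j i))\<^sup>2"]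
  by (simp add: hnorm_l2 l2_smult unit_vec_l2) (simp add: unit_vec_def)

lemma l2_finite_approximation:
  assumes x: "x \<in> carrier (l2 I)" and \<epsilon>: "0 < \<epsilon>"
  obtains F where "finite F" "hnorm (l2 I) (\<lambda>i. if i \<in> F then 0 else x i) < \<epsilon>"
proof -
  let ?f = "\<lambda>i. (cmod (x i))\<^sup>2"
  have summable: "?f summable_on UNIV" using x by (simp add: l2_carrier)
  then have "(sum ?f \<longlongrightarrow> infsum ?f UNIV) (finite_subsets_at_top UNIV)"
    using has_sum_def summable_iff_has_sum_infsum by blast
  then have "\<forall>\<^sub>F F in finite_subsets_at_top UNIV. dist (sum ?f F) (infsum ?f UNIV) < \<epsilon>\<^sup>2"
    using \<epsilon> by (simp add: tendstoD)
  then obtain F where F: "finite F" "dist (sum ?f F) (infsum ?f UNIV) < \<epsilon>\<^sup>2"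
    by (auto simp: eventually_finite_subsets_at_top)
  let ?g = "\<lambda>i. if i \<in> F then 0 else x i"
  have "?g \<in> carrier (l2 I)"
    by (rule l2_bounded_mult[OF x, of id _ 1]) (use x in \<open>auto simp: l2_carrier\<close>)
  then have "hnorm (l2 I) ?g = sqrt (\<Sum>\<^sub>\<infinity>i. (cmod (?g i))\<^sup>2)" by (rule hnorm_l2)
  also have "(\<Sum>\<^sub>\<infinity>i. (cmod (?g i))\<^sup>2) = infsum ?f (UNIV - F)"
    by (rule infsum_cong_neutral) auto
  also have "\<dots> = infsum ?f UNIV - infsum ?f F"
    using F summable by (intro infsum_Diff) auto
  also have "sqrt \<dots> < sqrt (\<epsilon>\<^sup>2)"
    using F by (intro real_sqrt_less_mono) (simp add: dist_real_def)
  finally have "hnorm (l2 I) ?g < \<epsilon>" using \<epsilon> by simp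
  with F(1) show ?thesis by (rule that)
qed

context
  fixes I :: "'i set" and \<sigma> :: "'i \<Rightarrow> 'i"
  assumes invol: "\<And>i. \<sigma> (\<sigma> i) = i" and inv_mem: "\<And>i. i \<in> I \<Longrightarrow> \<sigma> i \<in> I"
begin

lemma involution_bij: "bij \<sigma>"
  using invol by (metis bijI')

lemma l2_flip_outside: "f \<in> carrier (l2 I) \<Longrightarrow> i \<notin> I \<Longrightarrow> f (\<sigma> i) = 0"
  using inv_mem[of "\<sigma> i"] by (auto simp: invol l2_carrier)

lemma wop_linear: "linear_operator (l2 I) (wop_domain I \<phi> \<sigma>) (wop I \<phi> \<sigma>)"
proof -
  interpret module "ring_of_type_algebra :: complex ring" "l2 I" by (rule module_l2)
  have add: "(\<lambda>i. x i + y i) \<in> wop_domain I \<phi> \<sigma>"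
    if "x \<in> wop_domain I \<phi> \<sigma>" "y \<in> wop_domain I \<phi> \<sigma>" for x y
    using that l2_add[of "\<lambda>i. \<phi> i * x (\<sigma> i)" I "\<lambda>i. \<phi> i * y (\<sigma> i)"]
    by (auto simp: wop_domain_def l2_add distrib_left)
  have smult: "(\<lambda>i. c * x i) \<in> wop_domain I \<phi> \<sigma>" if "x \<in> wop_domain I \<phi> \<sigma>" for c x
    using that l2_smult[of "\<lambda>i. \<phi> i * x (\<sigma> i)" I c]
    by (auto simp: wop_domain_def l2_smult mult.left_commute)
  have neg: "\<ominus>\<^bsub>l2 I\<^esub> x = (\<lambda>i. -1 * x i)" if "x \<in> wop_domain I \<phi> \<sigma>" for x
    by (rule M.minus_equality) (use that l2_smult[of x I "-1"] in \<open>auto simp: wop_domain_def\<close>)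
  have "submodule (wop_domain I \<phi> \<sigma>) (ring_of_type_algebra :: complex ring) (l2 I)"
  proof (rule submoduleI)
    show "\<ominus>\<^bsub>l2 I\<^esub> a \<in> wop_domain I \<phi> \<sigma>" if "a \<in> wop_domain I \<phi> \<sigma>" for a
      using smult[OF that, of "-1"] neg[OF that] by simp
  qed (auto simp: add smult, auto simp: wop_domain_def l2_zero)
  then show ?thesis
    by (auto simp: linear_operator_def wop_def wop_domain_def l2_add l2_smult algebra_simps)
qed

text \<open>A weighted flip of a finitely supported vector is again finitely supported, so the
  domain contains all such vectors however fast the weight grows.\<close>

lemma wop_domain_dense: "dense_subset (l2 I) (wop_domain I \<phi> \<sigma>)"
  unfolding dense_subset_def
proof (intro conjI ballI allI impI)
  show "wop_domain I \<phi> \<sigma> \<subseteq> carrier (l2 I)" by (auto simp: wop_domain_def)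
  fix x and \<epsilon> :: real assume x: "x \<in> carrier (l2 I)" and "0 < \<epsilon>"
  then obtain F where F: "finite F" "hnorm (l2 I) (\<lambda>i. if i \<in> F then 0 else x i) < \<epsilon>"
    by (rule l2_finite_approximation)
  define v where "v = (\<lambda>i. if i \<in> F then x i else 0)"
  have v: "v \<in> carrier (l2 I)"
  proof (rule l2_finite_support)
    show "finite {i. v i \<noteq> 0}" using F(1) by (auto simp: v_def intro: finite_subset[of _ F])
  qed (use x in \<open>auto simp: v_def l2_carrier\<close>)
  have "(\<lambda>i. \<phi> i * v (\<sigma> i)) \<in> carrier (l2 I)"
  proof (rule l2_finite_support)
    show "finite {i. \<phi> i * v (\<sigma> i) \<noteq> 0}"
    proof (rule finite_subset)
      show "{i. \<phi> i * v (\<sigma> i) \<noteq> 0} \<subseteq> \<sigma> ` F"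
      proof
        fix i assume "i \<in> {i. \<phi> i * v (\<sigma> i) \<noteq> 0}"
        then have "\<sigma> i \<in> F" by (auto simp: v_def split: if_splits)
        from imageI[OF this, of \<sigma>] show "i \<in> \<sigma> ` F" by (simp add: invol)
      qed
    qed (use F in simp)
  qed (simp add: l2_flip_outside[OF v])
  then have "v \<in> wop_domain I \<phi> \<sigma>" using v by (simp add: wop_domain_def)
  moreover have "x \<ominus>\<^bsub>l2 I\<^esub> v = (\<lambda>i. if i \<in> F then 0 else x i)"
    unfolding l2_minus[OF x v] by (auto simp: v_def)
  ultimately show "\<exists>v\<in>wop_domain I \<phi> \<sigma>. hnorm (l2 I) (x \<ominus>\<^bsub>l2 I\<^esub> v) < \<epsilon>"
    using F(2) by (intro bexI[of _ v]) simp_all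
qed

text \<open>Testing the adjoint relation on unit vectors determines z coordinate by coordinate as
  the weighted flip of y. As z is square-summable, y lies in the maximal domain, so the adjoint is
  no larger than the operator. The other inclusion is a reindexing by \<sigma>.\<close>

lemma wop_self_adjoint:
  assumes sym: "\<And>i. i \<in> I \<Longrightarrow> \<phi> (\<sigma> i) = cnj (\<phi> i)"
  shows "self_adjoint (l2 I) (wop_domain I \<phi> \<sigma>) (wop I \<phi> \<sigma>)"
proof -
  let ?V = "wop_domain I \<phi> \<sigma>"
  have wop: "wop I \<phi> \<sigma> x = (\<lambda>i. \<phi> i * x (\<sigma> i))" if "x \<in> carrier (l2 I)" for x
    using that by (simp add: wop_def)
  have V: "x \<in> carrier (l2 I)" if "x \<in> ?V" for x
    using that by (simp add: wop_domain_def)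
  have "adjoint_graph (l2 I) ?V (wop I \<phi> \<sigma>) = {(x, wop I \<phi> \<sigma> x) | x. x \<in> ?V}"
  proof (intro equalityI subsetI)
    fix p assume "p \<in> adjoint_graph (l2 I) ?V (wop I \<phi> \<sigma>)"
    then obtain y z where p: "p = (y, z)" and y: "y \<in> carrier (l2 I)" and z: "z \<in> carrier (l2 I)"
      and adj: "\<And>x. x \<in> ?V \<Longrightarrow> cinner (l2 I) (wop I \<phi> \<sigma> x) y = cinner (l2 I) x z"
      by (auto simp: adjoint_graph_def)
    have "z j = \<phi> j * y (\<sigma> j)" for j
    proof (cases "j \<in> I")
      case True
      have u: "unit_vec j \<in> carrier (l2 I)" by (rule unit_vec_l2[OF True])
      have flip: "unit_vec j (\<sigma> i) = unit_vec (\<sigma> j) i" for i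
        using invol by (auto simp: unit_vec_def)
      have "(\<lambda>i. \<phi> i * unit_vec j (\<sigma> i)) \<in> carrier (l2 I)"
      proof (rule l2_finite_support)
        show "finite {i. \<phi> i * unit_vec j (\<sigma> i) \<noteq> 0}"
          by (rule finite_subset[of _ "{\<sigma> j}"]) (auto simp: flip unit_vec_def invol)
      qed (simp add: l2_flip_outside[OF u])
      then have "unit_vec j \<in> ?V" using u by (simp add: wop_domain_def)
      \<comment> \<open>Each sum has at most one nonzero term, at \<sigma>(j) on the left and at j
        on the right.\<close>
      from adj[OF this] have "(\<Sum>\<^sub>\<infinity>i. \<phi> i * unit_vec j (\<sigma> i) * cnj (y i)) = (\<Sum>\<^sub>\<infinity>i. unit_vec j i * cnj (z i))"
        by (simp add: wop[OF u])
      then have "\<phi> (\<sigma> j) * cnj (y (\<sigma> j)) = cnj (z j)"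
        using infsum_singleton_support[of "\<sigma> j" "\<lambda>i. \<phi> i * unit_vec j (\<sigma> i) * cnj (y i)"]
          infsum_singleton_support[of j "\<lambda>i. unit_vec j i * cnj (z i)"]
        by (simp only: flip) (simp add: unit_vec_def)
      then have "cnj (\<phi> j * y (\<sigma> j)) = cnj (z j)" using sym[OF True] by simp
      then show ?thesis by (simp only: complex_cnj_cancel_iff)
    next
      case False
      then show ?thesis using z l2_flip_outside[OF y] by (simp add: l2_carrier)
    qed
    then have "z = (\<lambda>j. \<phi> j * y (\<sigma> j))" by blast
    then show "p \<in> {(x, wop I \<phi> \<sigma> x) | x. x \<in> ?V}"
      using y z p by (auto simp: wop wop_domain_def)
  next
    fix p assume "p \<in> {(x, wop I \<phi> \<sigma> x) | x. x \<in> ?V}"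
    then obtain y where p: "p = (y, wop I \<phi> \<sigma> y)" and y: "y \<in> ?V" by auto
    have "cinner (l2 I) (wop I \<phi> \<sigma> x) y = cinner (l2 I) x (wop I \<phi> \<sigma> y)" if x: "x \<in> ?V" for x
    proof -
      have "(\<Sum>\<^sub>\<infinity>i. \<phi> i * x (\<sigma> i) * cnj (y i)) = (\<Sum>\<^sub>\<infinity>i. x i * cnj (\<phi> i * y (\<sigma> i)))"
      proof (rule infsum_reindex_bij_witness[of _ \<sigma> \<sigma>])
        fix i
        show "x (\<sigma> i) * cnj (\<phi> (\<sigma> i) * y (\<sigma> (\<sigma> i))) = \<phi> i * x (\<sigma> i) * cnj (y i)"
        proof (cases "i \<in> I")
          case True
          then show ?thesis by (simp add: sym invol)
        next
          case False
          then show ?thesis using l2_flip_outside[OF V[OF x]] by simp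
        qed
      qed (auto simp: invol)
      then show ?thesis by (simp add: wop V x y)
    qed
    then show "p \<in> adjoint_graph (l2 I) ?V (wop I \<phi> \<sigma>)"
      using y by (auto simp: p adjoint_graph_def wop V) (simp add: wop_domain_def)
  qed
  then show ?thesis
    using wop_linear wop_domain_dense by (simp add: self_adjoint_def)
qed

lemma wop_bounded:
  assumes bound: "\<And>i. i \<in> I \<Longrightarrow> cmod (\<phi> i) \<le> K" and K: "0 \<le> K"
  shows "wop_domain I \<phi> \<sigma> = carrier (l2 I)" "wop I \<phi> \<sigma> \<in> bounded_operators (l2 I)"
    "x \<in> carrier (l2 I) \<Longrightarrow> hnorm (l2 I) (wop I \<phi> \<sigma> x) \<le> K * hnorm (l2 I) x"
proof -
  have mem: "(\<lambda>i. \<phi> i * x (\<sigma> i)) \<in> carrier (l2 I)" if "x \<in> carrier (l2 I)" for x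
    by (rule l2_bounded_mult[OF that involution_bij, of _ K])
      (auto simp: l2_flip_outside[OF that] norm_mult intro: mult_right_mono bound)
  then show dom: "wop_domain I \<phi> \<sigma> = carrier (l2 I)"
    by (auto simp: wop_domain_def)
  have norm_le: "hnorm (l2 I) (wop I \<phi> \<sigma> x) \<le> K * hnorm (l2 I) x" if x: "x \<in> carrier (l2 I)" for x
  proof (rule l2_bounded_partial_sums(2))
    show "wop I \<phi> \<sigma> x i = 0" if "i \<notin> I" for i
      using x that by (simp add: wop_def l2_flip_outside)
    show "0 \<le> K * hnorm (l2 I) x" using K hnorm_l2_nonneg[OF x] by simp
    fix F :: "'i set" assume F: "finite F"
    have "(\<Sum>i\<in>F. (cmod (wop I \<phi> \<sigma> x i))\<^sup>2) \<le> (\<Sum>i\<in>F. K\<^sup>2 * (cmod (x (\<sigma> i)))\<^sup>2)"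
    proof (rule sum_mono)
      fix i
      show "(cmod (wop I \<phi> \<sigma> x i))\<^sup>2 \<le> K\<^sup>2 * (cmod (x (\<sigma> i)))\<^sup>2"
        using power_mono[OF bound, of i 2] l2_flip_outside[OF x, of i] x
        by (cases "i \<in> I") (auto simp: wop_def norm_mult power_mult_distrib intro: mult_right_mono)
    qed
    also have "\<dots> = K\<^sup>2 * (\<Sum>i\<in>\<sigma> ` F. (cmod (x i))\<^sup>2)"
      using involution_bij by (subst sum.reindex) (auto simp: sum_distrib_left bij_def inj_on_def)
    also have "\<dots> \<le> K\<^sup>2 * (hnorm (l2 I) x)\<^sup>2"
      using F x by (intro mult_left_mono l2_partial_sum_le) auto
    finally show "(\<Sum>i\<in>F. (cmod (wop I \<phi> \<sigma> x i))\<^sup>2) \<le> (K * hnorm (l2 I) x)\<^sup>2"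
      by (simp add: power_mult_distrib)
  qed
  then show "x \<in> carrier (l2 I) \<Longrightarrow> hnorm (l2 I) (wop I \<phi> \<sigma> x) \<le> K * hnorm (l2 I) x" .
  show "wop I \<phi> \<sigma> \<in> bounded_operators (l2 I)"
    using wop_linear[of \<phi>] norm_le unfolding dom bounded_operators_def wop_def by auto
qed

text \<open>The operator sends the unit vector at \<sigma>(i) to \<phi>(i) times the one at i, so
  its norm is the supremum of the moduli. The supremum is only asked to be approached, because
  semi-continuity yields states for each c < L(a) but not for L(a) itself.\<close>

lemma opnorm_wop:
  assumes bound: "\<And>i. i \<in> I \<Longrightarrow> cmod (\<phi> i) \<le> K" and K: "0 \<le> K"
    and attained: "\<And>c. 0 < c \<Longrightarrow> c < K \<Longrightarrow> \<exists>i\<in>I. c \<le> cmod (\<phi> i)"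
  shows "opnorm (l2 I) (wop I \<phi> \<sigma>) = K"
proof -
  let ?S = "{hnorm (l2 I) (wop I \<phi> \<sigma> x) | x. x \<in> carrier (l2 I) \<and> hnorm (l2 I) x \<le> 1}"
  have upper: "s \<le> K" if s: "s \<in> ?S" for s
  proof -
    obtain x where x: "x \<in> carrier (l2 I)" "hnorm (l2 I) x \<le> 1" "s = hnorm (l2 I) (wop I \<phi> \<sigma> x)"
      using s by auto
    then show ?thesis
      using wop_bounded(3)[of \<phi> K x] bound K x(1) mult_left_mono[OF x(2) K] by simp
  qed
  have zero: "0 \<in> ?S"
    using l2_zero by (intro CollectI exI[of _ "\<lambda>i. 0"]) (auto simp: wop_def hnorm_l2 l2_zero)
  have "c \<le> Sup ?S" if "0 < c" "c < K" for c
  proof -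
    obtain i where i: "i \<in> I" "c \<le> cmod (\<phi> i)" using attained \<open>0 < c\<close> \<open>c < K\<close> by blast
    have u: "unit_vec (\<sigma> i) \<in> carrier (l2 I)" by (rule unit_vec_l2[OF inv_mem[OF i(1)]])
    have "unit_vec (\<sigma> i) (\<sigma> j) = unit_vec i j" for j
      using invol by (metis unit_vec_def)
    then have "wop I \<phi> \<sigma> (unit_vec (\<sigma> i)) = (\<lambda>j. \<phi> i * unit_vec i j)"
      using u by (auto simp: wop_def unit_vec_def)
    then have "cmod (\<phi> i) = hnorm (l2 I) (wop I \<phi> \<sigma> (unit_vec (\<sigma> i)))"
      by (simp only: hnorm_unit_vec[OF i(1)])
    then have "cmod (\<phi> i) \<in> ?S"
      using u hnorm_unit_vec[OF inv_mem[OF i(1)], of 1] by (intro CollectI exI[of _ "unit_vec (\<sigma> i)"]) auto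
    then have "cmod (\<phi> i) \<le> Sup ?S" using upper by (intro cSup_upper bdd_aboveI)
    with i show ?thesis by linarith
  qed
  moreover have "0 \<le> Sup ?S" using zero upper by (intro cSup_upper bdd_aboveI)
  \<comment> \<open>For K = 0 there is no c to approximate with, and the zero vector provides the
    bound.\<close>
  ultimately have "K \<le> Sup ?S" using K dense_le_bounded[of 0 K "Sup ?S"] by (cases "K = 0") auto
  moreover have "Sup ?S \<le> K" using zero upper by (intro cSup_least) auto
  ultimately show ?thesis by (simp add: opnorm_def)
qed

end

text \<open>The quadratic form of the difference is the sum of (\<psi> - \<phi>)|x|^2; unit vectors
  isolate its coefficients.\<close>

lemma op_le_wop_id:
  assumes bounded: "\<And>i. i \<in> I \<Longrightarrow> \<bar>\<phi> i\<bar> \<le> K" "\<And>i. i \<in> I \<Longrightarrow> \<bar>\<psi> i\<bar> \<le> K'"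
  shows "op_le (l2 I) (wop I (\<lambda>i. of_real (\<phi> i)) id) (wop I (\<lambda>i. of_real (\<psi> i)) id)
    \<longleftrightarrow> (\<forall>i\<in>I. \<phi> i \<le> \<psi> i)"
proof -
  let ?A = "wop I (\<lambda>i. of_real (\<phi> i)) id" and ?B = "wop I (\<lambda>i. of_real (\<psi> i)) id"
  have mem: "(\<lambda>i. of_real (g i) * x i) \<in> carrier (l2 I)"
    if "\<And>i. i \<in> I \<Longrightarrow> \<bar>g i\<bar> \<le> M" "x \<in> carrier (l2 I)" for g M x
    by (rule l2_bounded_mult[OF that(2), of id _ M])
      (use that in \<open>auto simp: l2_carrier norm_mult intro: mult_right_mono\<close>)
  have eq: "cinner (l2 I) (?B x \<ominus>\<^bsub>l2 I\<^esub> ?A x) x = (\<Sum>\<^sub>\<infinity>i. of_real ((\<psi> i - \<phi> i) * (cmod (x i))\<^sup>2))"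
    if x: "x \<in> carrier (l2 I)" for x
    using x l2_minus[OF mem[OF bounded(2) x] mem[OF bounded(1) x]]
    by (simp add: wop_def left_diff_distrib[symmetric] mult.assoc complex_norm_square del: of_real_power)
  show ?thesis
  proof
    assume le: "op_le (l2 I) ?A ?B"
    show "\<forall>i\<in>I. \<phi> i \<le> \<psi> i"
    proof
      fix i assume i: "i \<in> I"
      have "cinner (l2 I) (?B (unit_vec i) \<ominus>\<^bsub>l2 I\<^esub> ?A (unit_vec i)) (unit_vec i) = of_real (\<psi> i - \<phi> i)"
        unfolding eq[OF unit_vec_l2[OF i]]
        by (subst infsum_singleton_support[of i]) (auto simp: unit_vec_def)
      then have "complex_of_real (\<psi> i - \<phi> i) \<in> \<real>\<^sub>\<ge>\<^sub>0"
        using le unit_vec_l2[OF i] unfolding op_le_def by metis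
      then show "\<phi> i \<le> \<psi> i" by (simp only: nonneg_Reals_of_real_iff)
    qed
  next
    assume le: "\<forall>i\<in>I. \<phi> i \<le> \<psi> i"
    show "op_le (l2 I) ?A ?B"
      unfolding op_le_def
    proof
      fix x assume x: "x \<in> carrier (l2 I)"
      have terms: "0 \<le> (\<psi> i - \<phi> i) * (cmod (x i))\<^sup>2" for i
        using le x by (cases "i \<in> I") (auto simp: l2_carrier)
      then have nonneg: "0 \<le> (\<Sum>\<^sub>\<infinity>i. (\<psi> i - \<phi> i) * (cmod (x i))\<^sup>2)"
        by (rule infsum_nonneg)
      \<comment> \<open>Summability is what identifies the complex sum with the nonnegative real
        one; the bounds on \<phi> and \<psi> supply the comparison.\<close>
      have "(\<lambda>i. (\<psi> i - \<phi> i) * (cmod (x i))\<^sup>2) summable_on UNIV"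
      proof (rule summable_on_comparison_test)
        show "(\<lambda>i. (K + K') * (cmod (x i))\<^sup>2) summable_on UNIV"
          using x by (intro summable_on_cmult_right) (simp add: l2_carrier)
        show "(\<psi> i - \<phi> i) * (cmod (x i))\<^sup>2 \<le> (K + K') * (cmod (x i))\<^sup>2" for i
        proof (cases "i \<in> I")
          case True
          then show ?thesis using bounded[OF True] by (intro mult_right_mono) auto
        next
          case False
          then show ?thesis using x by (simp add: l2_carrier)
        qed
      qed (rule terms)
      then have "((\<lambda>i. complex_of_real ((\<psi> i - \<phi> i) * (cmod (x i))\<^sup>2))
          has_sum of_real (\<Sum>\<^sub>\<infinity>i. (\<psi> i - \<phi> i) * (cmod (x i))\<^sup>2)) UNIV"
        by (intro has_sum_of_real has_sum_infsum)
      then show "cinner (l2 I) (?B x \<ominus>\<^bsub>l2 I\<^esub> ?A x) x \<in> \<real>\<^sub>\<ge>\<^sub>0"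
        unfolding eq[OF x] infsumI using nonneg by (simp add: infsumI del: of_real_mult of_real_diff of_real_power)
    qed
  qed
qed

section \<open>The Dirac operator\<close>

text \<open>The reciprocal of the distance of two states, hence $0$ for infinite distance. On the diagonal
  the supremum is over an unbounded set and its value is junk; this is harmless, because
  there the weight is always multiplied by $\nu(a) - \mu(a) = 0$.\<close>
definition lip_weight :: "('a \<Rightarrow> real) \<Rightarrow> ('a \<Rightarrow> real) \<times> ('a \<Rightarrow> real) \<Rightarrow> real" where
  "lip_weight L = (\<lambda>(\<mu>, \<nu>). Sup {t. 0 \<le> t \<and> (\<forall>a. t * \<bar>\<mu> a - \<nu> a\<bar> \<le> L a)})"

lemma lip_weight_swap: "lip_weight L (prod.swap p) = lip_weight L p"
  by (simp add: lip_weight_def abs_minus_commute split: prod.split)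

lemma lip_weight_bdd_above:
  fixes \<mu> \<nu> L :: "'a \<Rightarrow> real"
  assumes "\<mu> a \<noteq> \<nu> a"
  shows "bdd_above {t. 0 \<le> t \<and> (\<forall>a. t * \<bar>\<mu> a - \<nu> a\<bar> \<le> L a)}"
  by (rule bdd_aboveI[of _ "L a / \<bar>\<mu> a - \<nu> a\<bar>"]) (use assms in \<open>auto simp: field_simps\<close>)

text \<open>When a separates the states, each admissible t is at most L(a) / |\<mu>(a) - \<nu>(a)|,
  and so is the supremum; otherwise the product is 0 whatever the weight.\<close>

lemma lip_weight_le:
  assumes nonneg: "\<And>a. 0 \<le> L a"
  shows "\<bar>lip_weight L (\<mu>, \<nu>) * (\<nu> a - \<mu> a)\<bar> \<le> L a"
proof (cases "\<mu> a = \<nu> a")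
  case True
  then show ?thesis using nonneg by simp
next
  case False
  let ?T = "{t. 0 \<le> t \<and> (\<forall>a. t * \<bar>\<mu> a - \<nu> a\<bar> \<le> L a)}"
  have zero: "0 \<in> ?T" using nonneg by simp
  have "Sup ?T \<le> L a / \<bar>\<mu> a - \<nu> a\<bar>"
    using zero False by (intro cSup_least) (auto simp: field_simps)
  moreover have "0 \<le> Sup ?T"
    using zero lip_weight_bdd_above[of \<mu> a \<nu> L] False by (intro cSup_upper)
  ultimately have "0 \<le> lip_weight L (\<mu>, \<nu>)" "lip_weight L (\<mu>, \<nu>) * \<bar>\<mu> a - \<nu> a\<bar> \<le> L a"
    using False by (simp_all add: lip_weight_def pos_le_divide_eq)
  then show ?thesis by (simp add: abs_mult abs_minus_commute[of "\<nu> a"])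
qed

lemma lip_weight_ge:
  assumes "0 \<le> t" "\<And>a. t * \<bar>\<mu> a - \<nu> a\<bar> \<le> L a"
  shows "t * \<bar>\<nu> a - \<mu> a\<bar> \<le> \<bar>lip_weight L (\<mu>, \<nu>) * (\<nu> a - \<mu> a)\<bar>"
proof (cases "\<mu> a = \<nu> a")
  case False
  have "t \<le> lip_weight L (\<mu>, \<nu>)"
    unfolding lip_weight_def using assms lip_weight_bdd_above[of \<mu> a \<nu> L] False
    by (auto intro: cSup_upper)
  then show ?thesis by (simp add: abs_mult mult_right_mono)
qed simp

theorem mainTheorem8:
  fixes e :: "'a::ordered_real_vector" and L :: "'a \<Rightarrow> real"
  assumes "order_unit_space e"
    and "lip_norm e L"
    and "lower_semicontinuous e L"
  shows "\<exists>(H :: (('a \<Rightarrow> real) \<times> ('a \<Rightarrow> real) \<Rightarrow> complex) hilbert) V D B \<pi>.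
    complex_hilbert_space H \<and> self_adjoint H V D \<and>
    operator_order_unit_space H B \<and> order_unit_isomorphism e H B \<pi> \<and>
    (\<forall>a. \<exists>C. is_bounded_commutator H V D (\<pi> a) C \<and> L a = opnorm H C)"
proof -
  note ou = assms(1)
  have L: "seminorm L" and L_zero: "L a = 0 \<longleftrightarrow> a \<in> range (\<lambda>r. r *\<^sub>R e)" for a
    using assms(2) by (auto simp: lip_norm_def)
  have L_nonneg: "0 \<le> L a" for a using L by (simp add: seminorm_def)
  have Le: "L e = 0" by (subst L_zero) (auto intro: range_eqI[of _ _ 1])
  define I where "I = ou_states e \<times> ou_states e"
  define H where "H = l2 I"
  define w where "w = (\<lambda>p. complex_of_real (lip_weight L p))"
  define V where "V = wop_domain I w prod.swap"
  define D where "D = wop I w prod.swap"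
  define \<pi> where "\<pi> = (\<lambda>a. wop I (\<lambda>p. of_real (fst p a)) id)"
  have id: "id (id p) = p" "p \<in> I \<Longrightarrow> id p \<in> I" for p :: "('a \<Rightarrow> real) \<times> ('a \<Rightarrow> real)"
    by simp_all
  have swap: "prod.swap (prod.swap p) = p" "p \<in> I \<Longrightarrow> prod.swap p \<in> I"
    for p :: "('a \<Rightarrow> real) \<times> ('a \<Rightarrow> real)"
    by (auto simp: I_def)
  obtain m where m: "\<bar>\<mu> a\<bar> \<le> m a" if "\<mu> \<in> ou_states e" for \<mu> a
    using ou_states_bounded[OF ou] by metis
  have state_lin: "linear \<mu>" if "\<mu> \<in> ou_states e" for \<mu>
    using that by (simp add: ou_states_def)
  \<comment> \<open>The absolute value makes the bound nonnegative even if there are no states, when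
    nothing is known about \<open>m a\<close>.\<close>
  have fst_bound: "\<bar>fst p a\<bar> \<le> \<bar>m a\<bar>" if "p \<in> I" for p a
    using m[of "fst p" a] that by (auto simp: I_def)
  have \<pi>_apply: "\<pi> a x = (\<lambda>p. of_real (fst p a) * x p)" if "x \<in> carrier H" for a x
    using that by (simp add: \<pi>_def wop_def H_def)
  have \<pi>_dom: "wop_domain I (\<lambda>p. of_real (fst p a)) id = carrier H" for a
    unfolding H_def by (rule wop_bounded(1)[OF id, where K = "\<bar>m a\<bar>"]) (auto simp: fst_bound)
  have \<pi>_bounded: "\<pi> a \<in> bounded_operators H" for a
    unfolding H_def \<pi>_def by (rule wop_bounded(2)[OF id, where K = "\<bar>m a\<bar>"]) (auto simp: fst_bound)
  have \<pi>_sa: "self_adjoint H (carrier H) (\<pi> a)" for a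
  proof -
    have "self_adjoint (l2 I) (wop_domain I (\<lambda>p. of_real (fst p a)) id) (wop I (\<lambda>p. of_real (fst p a)) id)"
      by (rule wop_self_adjoint[OF id]) simp_all
    then show ?thesis
      unfolding \<pi>_dom by (simp only: \<pi>_def H_def)
  qed
  have \<pi>_mem: "(\<lambda>p. of_real (fst p a) * x p) \<in> carrier H" if "x \<in> carrier H" for a x
    using that[folded \<pi>_dom[of a]] by (simp add: wop_domain_def H_def)
  \<comment> \<open>Coordinates are linear in a only for pairs of states. Elsewhere the vectors
    vanish, which settles those coordinates in the identities below.\<close>
  have outside: "x p = 0" if "x \<in> carrier H" "p \<notin> I" for x p
    using that unfolding H_def l2_carrier by blast
  have \<pi>_add: "\<pi> (a + b) = op_add H (\<pi> a) (\<pi> b)" for a b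
  proof
    fix x show "\<pi> (a + b) x = op_add H (\<pi> a) (\<pi> b) x"
    proof (cases "x \<in> carrier H")
      case True
      have "of_real (fst p (a + b)) * x p = of_real (fst p a) * x p + of_real (fst p b) * x p" for p
      proof (cases "p \<in> I")
        case p: True
        then have "fst p (a + b) = fst p a + fst p b" by (intro linear_add state_lin) (auto simp: I_def)
        then show ?thesis by (simp add: distrib_right)
      next
        case False
        then show ?thesis using outside[OF True] by simp
      qed
      then show ?thesis using True by (simp add: op_add_def \<pi>_apply) (simp add: H_def)
    qed (simp add: op_add_def \<pi>_def wop_def H_def)
  qed
  have \<pi>_scale: "\<pi> (r *\<^sub>R a) = op_scaleR H r (\<pi> a)" for r a
  proof
    fix x show "\<pi> (r *\<^sub>R a) x = op_scaleR H r (\<pi> a) x"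
    proof (cases "x \<in> carrier H")
      case True
      have "of_real (fst p (r *\<^sub>R a)) * x p = of_real r * (of_real (fst p a) * x p)" for p
      proof (cases "p \<in> I")
        case p: True
        then have "fst p (r *\<^sub>R a) = r * fst p a"
          using linear_scale[OF state_lin, of "fst p" r a] by (auto simp: I_def)
        then show ?thesis by simp
      next
        case False
        then show ?thesis using outside[OF True] by simp
      qed
      then show ?thesis using True by (simp only: op_scaleR_def restrict_apply' \<pi>_apply) (simp add: H_def)
    qed (simp add: op_scaleR_def \<pi>_def wop_def H_def)
  qed
  have \<pi>_one: "\<pi> e = op_id H"
  proof
    fix x show "\<pi> e x = op_id H x"
    proof (cases "x \<in> carrier H")
      case True
      have "of_real (fst p e) * x p = x p" for p
        using outside[OF True, of p] by (cases "p \<in> I") (auto simp: I_def ou_states_def)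
      then show ?thesis using True by (simp only: op_id_def restrict_apply' \<pi>_apply)
    qed (simp add: op_id_def \<pi>_def wop_def H_def)
  qed
  have \<pi>_le: "a \<le> b \<longleftrightarrow> op_le H (\<pi> a) (\<pi> b)" for a b
  proof -
    have "op_le H (\<pi> a) (\<pi> b) \<longleftrightarrow> (\<forall>p\<in>I. fst p a \<le> fst p b)"
      unfolding H_def \<pi>_def by (rule op_le_wop_id[OF fst_bound fst_bound])
    also have "\<dots> \<longleftrightarrow> (\<forall>\<mu>\<in>ou_states e. \<mu> a \<le> \<mu> b)"
      by (auto simp: I_def)
    finally show ?thesis using le_iff_ou_states[OF ou] by simp
  qed
  \<comment> \<open>Injectivity comes from the order: equal images give a \<le> b and b \<le>
    a.\<close>
  have "inj \<pi>"
  proof (rule injI)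
    fix a b assume "\<pi> a = \<pi> b"
    then show "a = b" using \<pi>_le[of a a] \<pi>_le[of b b] \<pi>_le[of a b] \<pi>_le[of b a] by simp
  qed
  then have iso: "order_unit_isomorphism e H (range \<pi>) \<pi>"
    using \<pi>_add \<pi>_scale \<pi>_one \<pi>_le by (simp add: order_unit_isomorphism_def bij_betw_def)
  have space: "operator_order_unit_space H (range \<pi>)"
    unfolding operator_order_unit_space_def
    using \<pi>_bounded \<pi>_sa by (auto simp flip: \<pi>_add \<pi>_scale \<pi>_one)
  have D_sa: "self_adjoint H V D"
    unfolding H_def V_def D_def
    by (rule wop_self_adjoint[OF swap]) (simp_all add: w_def lip_weight_swap)
  have comm: "\<exists>C. is_bounded_commutator H V D (\<pi> a) C \<and> L a = opnorm H C" for a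
  proof -
    define \<kappa> where "\<kappa> = (\<lambda>p. w p * of_real (snd p a - fst p a))"
    define C where "C = wop I \<kappa> prod.swap"
    have \<kappa>_abs: "cmod (\<kappa> p) = \<bar>lip_weight L p * (snd p a - fst p a)\<bar>" for p
      by (simp only: \<kappa>_def w_def norm_mult norm_of_real abs_mult)
    have \<kappa>_le: "cmod (\<kappa> p) \<le> L a" for p
      unfolding \<kappa>_abs using lip_weight_le[of L "fst p" "snd p" a] L_nonneg by simp
    have C_norm: "opnorm H C = L a"
      unfolding H_def C_def
    proof (rule opnorm_wop[OF swap])
      fix c assume c: "0 < c" "c < L a"
      obtain t \<mu> \<nu> where t: "0 \<le> t" "\<mu> \<in> ou_states e" "\<nu> \<in> ou_states e"
        "\<And>x. t * \<bar>\<mu> x - \<nu> x\<bar> \<le> L x" "c \<le> t * (\<mu> a - \<nu> a)"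
        by (rule lower_semicontinuous_separation[OF ou L Le assms(3) c]) (rule that)
      note t(5)
      also have "t * (\<mu> a - \<nu> a) \<le> t * \<bar>\<nu> a - \<mu> a\<bar>"
        using t(1) by (intro mult_left_mono) auto
      also have "\<dots> \<le> cmod (\<kappa> (\<mu>, \<nu>))"
        unfolding \<kappa>_abs using lip_weight_ge[OF t(1,4), where a = a] by simp
      finally show "\<exists>i\<in>I. c \<le> cmod (\<kappa> i)"
        using t(2,3) by (intro bexI[of _ "(\<mu>, \<nu>)"]) (auto simp: I_def)
    qed (use \<kappa>_le L_nonneg in auto)
    have C_bounded: "C \<in> bounded_operators H"
      unfolding H_def C_def by (rule wop_bounded(2)[OF swap \<kappa>_le L_nonneg])
    have V: "x \<in> carrier H" "(\<lambda>p. w p * x (prod.swap p)) \<in> carrier H" if "x \<in> V" for x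
      using that by (auto simp: V_def H_def wop_domain_def)
    have C_dom: "wop_domain I \<kappa> prod.swap = carrier H"
      unfolding H_def by (rule wop_bounded(1)[OF swap \<kappa>_le L_nonneg])
    have C_mem: "(\<lambda>p. \<kappa> p * x (prod.swap p)) \<in> carrier H" if "x \<in> carrier H" for x
      using that[folded C_dom] by (simp add: wop_domain_def H_def)
    \<comment> \<open>The commutator at one coordinate: u is the weight, r and s are the values of a
      at the first and second state, z is the flipped coordinate of x.\<close>
    have leibniz: "u * (s * z) = r * (u * z) + u * (s - r) * z" for u s r z :: complex
      by (simp only: right_diff_distrib left_diff_distrib mult.assoc mult.left_commute[of u r z]
          add.commute[of _ "_ - _"] diff_add_cancel)
    have key: "w p * (of_real (fst (prod.swap p) a) * x (prod.swap p))
        = of_real (fst p a) * (w p * x (prod.swap p)) + \<kappa> p * x (prod.swap p)" for x p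
      unfolding \<kappa>_def of_real_diff fst_swap by (rule leibniz)
    \<comment> \<open>Invariance of the domain follows from boundedness of the commutator: by
      \<open>key\<close>, D(ax) is a(Dx) + Cx, and both summands are square-summable although D is
      possibly unbounded.\<close>
    have DT: "(\<lambda>p. w p * (of_real (fst (prod.swap p) a) * x (prod.swap p))) \<in> carrier H"
      if "x \<in> V" for x
      unfolding key[of _ x] H_def
      by (rule l2_add[OF \<pi>_mem[OF V(2)[OF that], unfolded H_def] C_mem[OF V(1)[OF that], unfolded H_def]])
    have "\<pi> a x \<in> V" if "x \<in> V" for x
      using DT[OF that] \<pi>_mem[OF V(1)[OF that], of a] unfolding \<pi>_apply[OF V(1)[OF that]]
      by (simp add: V_def wop_domain_def H_def)
    then have V_invariant: "\<pi> a ` V \<subseteq> V" by blast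
    have C_eq: "C x = D (\<pi> a x) \<ominus>\<^bsub>H\<^esub> \<pi> a (D x)" if x: "x \<in> V" for x
    proof -
      have D_x: "D x = (\<lambda>p. w p * x (prod.swap p))"
        using V(1)[OF x] by (simp add: D_def wop_def H_def)
      have D_pi: "D (\<pi> a x) = (\<lambda>p. w p * (of_real (fst (prod.swap p) a) * x (prod.swap p)))"
        using \<pi>_mem[OF V(1)[OF x], of a] unfolding \<pi>_apply[OF V(1)[OF x]]
        by (simp add: D_def wop_def H_def)
      have pi_D: "\<pi> a (D x) = (\<lambda>p. of_real (fst p a) * (w p * x (prod.swap p)))"
        unfolding D_x by (rule \<pi>_apply[OF V(2)[OF x]])
      have "D (\<pi> a x) \<ominus>\<^bsub>H\<^esub> \<pi> a (D x) = (\<lambda>p. \<kappa> p * x (prod.swap p))"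
        unfolding D_pi pi_D H_def
          l2_minus[OF DT[OF x, unfolded H_def] \<pi>_mem[OF V(2)[OF x], of a, unfolded H_def]]
        by (rule ext, subst key, rule add_diff_cancel_left')
      moreover have "C x = (\<lambda>p. \<kappa> p * x (prod.swap p))"
        using V(1)[OF x] by (simp add: C_def wop_def H_def)
      ultimately show ?thesis by simp
    qed
    show ?thesis
      unfolding is_bounded_commutator_def
      by (rule exI[of _ C], intro conjI ballI V_invariant C_bounded C_eq C_norm[symmetric])
  qed
  have "complex_hilbert_space H"
    unfolding H_def by (rule complex_hilbert_space_l2)
  then have "complex_hilbert_space H \<and> self_adjoint H V D \<and> operator_order_unit_space H (range \<pi>) \<and>
      order_unit_isomorphism e H (range \<pi>) \<pi> \<and>
      (\<forall>a. \<exists>C. is_bounded_commutator H V D (\<pi> a) C \<and> L a = opnorm H C)"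
    by (intro conjI allI D_sa space iso comm)
  then show ?thesis by (intro exI)
qed

end
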